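(* The number $\mathrm{megs}(G)$ of vertices in a minimum edge geodetic set of a series-parallel digraph $G$ can be computed recursively, together with $\mathrm{sp}(G)$ and $\mathrm{cmegs}(G)$, by the following rules, i.e. the following equalities hold. 1. For the initial series-parallel digraph $I_{(s,t)}$: (a) $\mathrm{sp}(I_{(s,t)})=1$, (b) $\mathrm{megs}(I_{(s,t)})=2$, (c) $\mathrm{cmegs}(I_{(s,t)})=\text{undefined}$. 2. For the series composition $G\updownarrow G'$ of two series-parallel digraphs $G$ and $G'$: (a) $\mathrm{sp}(G\updownarrow G')=\mathrm{sp}(G)+\mathrm{sp}(G')$; (b) $\mathrm{megs}(G\updownarrow G')=\mathrm{megs}(G)+\mathrm{megs}(G')-2$; (c) $\mathrm{cmegs}(G\updownarrow G')=\mathrm{megs}(G)+\mathrm{megs}(G')-2$ if [$\mathrm{megs}(G)>2$ and $\mathrm{megs}(G')>2$] or [$\mathrm{megs}(G)=\mathrm{cmegs}(G)$] or [$\mathrm{megs}(G')=\mathrm{cmegs}(G')$]; and $\mathrm{cmegs}(G\updownarrow G')=\mathrm{megs}(G)+\mathrm{megs}(G')-1$ otherwise. 3. For the parallel composition $G\leftrightarrow G'$ of two series-parallel digraphs $G$ and $G'$: (a) $\mathrm{sp}(G\leftrightarrow G')=\min\{\mathrm{sp}(G),\mathrm{sp}(G')\}$; (b) $\mathrm{megs}(G\leftrightarrow G')=\begin{cases}\mathrm{megs}(G)+\mathrm{megs}(G')-2 & \text{if } \mathrm{sp}(G)=\mathrm{sp}(G'),\\ \mathrm{megs}(G)+\mathrm{cmegs}(G')-2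 & \text{if } \mathrm{sp}(G)<\mathrm{sp}(G'),\\ \mathrm{cmegs}(G)+\mathrm{megs}(G')-2 & \text{if } \mathrm{sp}(G)>\mathrm{sp}(G');\end{cases}$ (c) $\mathrm{cmegs}(G\leftrightarrow G')=\text{undefined}$ if $\mathrm{cmegs}(G)=\text{undefined}$ or $\mathrm{cmegs}(G')=\text{undefined}$, and $\mathrm{cmegs}(G\leftrightarrow G')=\mathrm{cmegs}(G)+\mathrm{cmegs}(G')-2$ otherwise.
   Context: Directed graphs are finite, with edge set $E\subseteq V\times V$ (so no multiple edges). The length of a path is the number of its edges; a shortest path from $u$ to $v$ is a directed path from $u$ to $v$ of minimum length. Series-parallel digraphs. For $E\subseteq V\times V$ and $u',u\in V$ let $\mathrm{merge}_{u'\to u}(E)=\{(v,w)\mid v\ne u',\ w\neq u',\ (v,w)\in E\}\cup\{(v,u)\mid v\ne u',\ (v,u')\in E\}\cup\{(u,w)\mid w\ne u',\ (u',w)\in E\}$. Series-parallel digraphs are systems $G=(V,E,s,t)$, with $(V,E)$ a directed graph and $s\ne t$ in $V$ (source vertex $s$, target vertex $t$), generated recursively as follows. - $I_{(s,t)}=(\{s,t\},\{(s,t)\},s,t)$ is a series-parallel digraph (the initial series-parallel digraph). - If $G=(V,E,s,t)$ and $G'=(V',E',s',t')$ are series-parallel digraphs (with $V\cap V'=\emptyset$), then so are: the series composition $G\updownarrow G'$, with vertex set $(V\cup V')\setminus\{s'\}$, edge set $\mathrm{merge}_{s'\to t}(E\cup E')$, source $s$, target $t'$; and the parallel composition $G\leftrightarrow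 G'$, with vertex set $(V\cup V')\setminus\{s',t'\}$, edge set $\mathrm{merge}_{s'\to s}(\mathrm{merge}_{t'\to t}(E\cup E'))$, source $s$, target $t$. A set $S\subseteq V$ is an edge geodetic set of $G$ if every edge of $E$ lies on a shortest path from a vertex of $S$ to a vertex of $S$. A set $S\subseteq V$ is a closed edge geodetic set of $G=(V,E,s,t)$ if every edge $e\in E$ lies on a shortest path from a vertex $u\in S$ to a vertex $v\in S$ such that $u\neq s$ or $v\ne t$. $\mathrm{megs}(G)$ is the minimum number of vertices of an edge geodetic set of $G$. $\mathrm{cmegs}(G)$ is the minimum number of vertices of a closed edge geodetic set of $G$ if one exists, and $\mathrm{cmegs}(G)=\text{undefined}$ if $G$ has no closed edge geodetic set (an equation between a number and "undefined" is regarded as false). $\mathrm{sp}(G)$ is the length of a shortest path from the source $s$ to the target $t$ in $G$. *)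

theory Defs
  imports "Graph_Theory.Pair_Digraph"
begin

record 'a st_digraph = "'a pair_pre_digraph" +
  source :: 'a
  target :: 'a

abbreviation graph_of :: "'a st_digraph \<Rightarrow> ('a, 'a \<times> 'a) pre_digraph" where
  "graph_of G \<equiv> with_proj (pair_pre_digraph.truncate G)"


subsection \<open>Series-parallel digraphs\<close>

definition merge :: "'a \<Rightarrow> 'a \<Rightarrow> 'a rel \<Rightarrow> 'a rel" where
  "merge u' u E =
     {(v, w) | v w. v \<noteq> u' \<and> w \<noteq> u' \<and> (v, w) \<in> E} \<union>
     {(v, u) | v. v \<noteq> u' \<and> (v, u') \<in> E} \<union>
     {(u, w) | w. w \<noteq> u' \<and> (u', w) \<in> E}"

definition initial_spd :: "'a \<Rightarrow> 'a \<Rightarrow> 'a st_digraph" where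
  "initial_spd s t = \<lparr> pverts = {s, t}, parcs = {(s, t)}, source = s, target = t \<rparr>"

definition series_comp :: "'a st_digraph \<Rightarrow> 'a st_digraph \<Rightarrow> 'a st_digraph"
    (infixl \<open>\<updownarrow>\<close> 65) where
  "G \<updownarrow> G' =
     \<lparr> pverts = (pverts G \<union> pverts G') - {source G'},
       parcs = merge (source G') (target G) (parcs G \<union> parcs G'),
       source = source G, target = target G' \<rparr>"

definition parallel_comp :: "'a st_digraph \<Rightarrow> 'a st_digraph \<Rightarrow> 'a st_digraph"
    (infixl \<open>\<leftrightarrow>\<close> 65) where
  "G \<leftrightarrow> G' =
     \<lparr> pverts = (pverts G \<union> pverts G') - {source G', target G'},
       parcs = merge (source G') (source G)
                 (merge (target G') (target G) (parcs G \<union> parcs G')),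
       source = source G, target = target G \<rparr>"

inductive series_parallel :: "'a st_digraph \<Rightarrow> bool" where
  initial: "s \<noteq> t \<Longrightarrow> series_parallel (initial_spd s t)"
| series: "\<lbrakk> series_parallel G; series_parallel G'; pverts G \<inter> pverts G' = {} \<rbrakk>
    \<Longrightarrow> series_parallel (G \<updownarrow> G')"
| parallel: "\<lbrakk> series_parallel G; series_parallel G'; pverts G \<inter> pverts G' = {} \<rbrakk>
    \<Longrightarrow> series_parallel (G \<leftrightarrow> G')"

lemma series_parallel_wf:
  assumes "series_parallel G"
  shows "finite (pverts G)" "parcs G \<subseteq> pverts G \<times> pverts G"
    "source G \<in> pverts G" "target G \<in> pverts G" "source G \<noteq> target G"
proof -
  have "finite (pverts G) \<and> parcs G \<subseteq> pverts G \<times> pverts G \<and>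
    source G \<in> pverts G \<and> target G \<in> pverts G \<and> source G \<noteq> target G"
    using assms
  proof induction
    case (initial s t)
    then show ?case by (simp add: initial_spd_def)
  next
    case (series G G')
    then show ?case by (auto simp: series_comp_def merge_def)
  next
    case (parallel G G')
    then show ?case by (auto simp: parallel_comp_def merge_def)
  qed
  then show "finite (pverts G)" "parcs G \<subseteq> pverts G \<times> pverts G"
    "source G \<in> pverts G" "target G \<in> pverts G" "source G \<noteq> target G" by blast+
qed


subsection \<open>Shortest paths and edge geodetic sets\<close>

text \<open>Paths are lists of arcs, so \<^term>\<open>length p\<close> is the number of edges of the path.\<close>

definition shortest_path :: "'a st_digraph \<Rightarrow> 'a \<Rightarrow> ('a \<times> 'a) list \<Rightarrow> 'a \<Rightarrow> bool" where
  "shortest_path G u p v \<longleftrightarrow>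
     pre_digraph.apath (graph_of G) u p v \<and>
     (\<forall>q. pre_digraph.apath (graph_of G) u q v \<longrightarrow> length p \<le> length q)"

definition edge_geodetic_set :: "'a st_digraph \<Rightarrow> 'a set \<Rightarrow> bool" where
  "edge_geodetic_set G S \<longleftrightarrow> S \<subseteq> pverts G \<and>
     (\<forall>e \<in> parcs G. \<exists>u \<in> S. \<exists>v \<in> S. \<exists>p. shortest_path G u p v \<and> e \<in> set p)"

definition closed_edge_geodetic_set :: "'a st_digraph \<Rightarrow> 'a set \<Rightarrow> bool" where
  "closed_edge_geodetic_set G S \<longleftrightarrow> S \<subseteq> pverts G \<and>
     (\<forall>e \<in> parcs G. \<exists>u \<in> S. \<exists>v \<in> S. \<exists>p. shortest_path G u p v \<and> e \<in> set p \<and>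
        (u \<noteq> source G \<or> v \<noteq> target G))"

text \<open>
  The minima below are over nonempty sets of numbers for every series-parallel digraph:
  the set of all vertices is edge geodetic, and the target is reachable from the source.
  The only minimum that may fail to exist is the one in \<open>cmegs\<close>, where
  \<^term>\<open>None\<close> means undefined.
\<close>

definition megs :: "'a st_digraph \<Rightarrow> nat" where
  "megs G = (LEAST k. \<exists>S. edge_geodetic_set G S \<and> card S = k)"

definition cmegs :: "'a st_digraph \<Rightarrow> nat option" where
  "cmegs G =
     (if \<exists>S. closed_edge_geodetic_set G S
      then Some (LEAST k. \<exists>S. closed_edge_geodetic_set G S \<and> card S = k)
      else None)"

definition sp :: "'a st_digraph \<Rightarrow> nat" where
  "sp G = (LEAST k. \<exists>p. shortest_path G (source G) p (target G) \<and> length p = k)"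

end

theory Submission
  imports Defs
begin

text \<open>The recursion rests on three facts about networks with two terminals in which nothing enters the
  source \<open>s\<close>, nothing leaves the target \<open>t\<close>, there are no loops, and every vertex lies on a walk
  from \<open>s\<close> to \<open>t\<close>. First, every edge geodetic set contains both terminals, and a closed one exists
  iff there is no edge from \<open>s\<close> to \<open>t\<close>. The other two describe the compositions. Edge geodetic
  and closed edge geodetic sets are treated together, as sets whose members serve as end points of
  shortest paths subject to a relation of forbidden pairs of end points.

  In a series composition the common vertex \<open>c\<close> separates the two parts. An edge of the left part
  lies on a shortest path from \<open>u\<close> to a vertex \<open>v\<close> of the right part iff it lies on one from \<open>u\<close> to
  \<open>c\<close> (\<open>geodesic_to_right\<close>, \<open>geodesic_trace_left\<close>). Hence both traces of an edge geodetic set become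
  edge geodetic sets of the parts when \<open>c\<close> is added. Conversely, edge geodetic sets of the parts can
  be united and \<open>c\<close> dropped, since paths ending in \<open>c\<close> can be prolonged to \<open>t\<close>. As \<open>c\<close> belonged to
  both sets, this saves two vertices. For closed sets the only obstacles are the paths from \<open>s\<close> to \<open>c\<close>
  and from \<open>c\<close> to \<open>t\<close>, which must be prolonged to a vertex other than \<open>t\<close> or \<open>s\<close>, respectively. This
  is possible if both sets have more than two vertices. It is also possible if one of them is closed:
  such a set does without the path between its own terminals, and it always has a third vertex
  (\<open>geodetic_closed_extra\<close>), which serves the paths of the other part. If minimum sets admit none of
  this, then keeping \<open>c\<close> costs one vertex, and \<open>series_closed_min_size\<close> shows that this cannot be
  avoided.

  In a parallel composition every walk stays in one part (\<open>walk_split\<close>), so the parts interact only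
  through the walks from \<open>s\<close> to \<open>t\<close>: if one part is strictly shorter, then the other one has lost the
  pair \<open>(s, t)\<close> of end points. Thus a set is geodetic iff both traces are, with \<open>(s, t)\<close>
  forbidden in the longer part (\<open>geodetic_parallel_iff\<close>). The traces overlap in the two terminals.

  Both compositions are first treated for networks that share vertices. The digraphs of the
  recursive definition have disjoint vertex sets, and merging vertices is an injective renaming of
  the second digraph followed by such a union.\<close>

section \<open>Edges on shortest walks\<close>

text \<open>Existence of an edge on a shortest path is expressed by lengths only: some walk through
  the edge is no longer than any walk between the same end points. A shortest walk is
  automatically a path, so nothing is lost, and relation powers can be split and concatenated
  more easily than lists of arcs. The strict inequality accounts for the edge itself.\<close>

definition geodesic_edge :: "'a rel \<Rightarrow> 'a \<Rightarrow> 'a \<Rightarrow> 'a \<times> 'a \<Rightarrow> bool" where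
  "geodesic_edge E u v e \<longleftrightarrow> e \<in> E \<and>
     (\<exists>i j. (u, fst e) \<in> E ^^ i \<and> (snd e, v) \<in> E ^^ j \<and> (\<forall>k. (u, v) \<in> E ^^ k \<longrightarrow> i + j < k))"

definition walk_dist :: "'a rel \<Rightarrow> 'a \<Rightarrow> 'a \<Rightarrow> nat" where
  "walk_dist E u v = (LEAST k. (u, v) \<in> E ^^ k)"

text \<open>The relation \<^term>\<open>F\<close> holds the pairs of end points that must not be used. Edge geodetic
  sets are the case \<^term>\<open>F = {}\<close>, closed edge geodetic sets the case where
  \<^term>\<open>F\<close> consists of the pair of terminals. Keeping \<^term>\<open>F\<close> variable lets one
  argument serve both.\<close>

definition geodetic :: "'a set \<Rightarrow> 'a rel \<Rightarrow> 'a rel \<Rightarrow> 'a set \<Rightarrow> bool" where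
  "geodetic V E F S \<longleftrightarrow> S \<subseteq> V \<and>
     (\<forall>e\<in>E. \<exists>u\<in>S. \<exists>v\<in>S. (u, v) \<notin> F \<and> geodesic_edge E u v e)"

text \<open>A relation instead of a least number, because closed edge geodetic sets need not exist.\<close>

definition is_min_size :: "'a set \<Rightarrow> 'a rel \<Rightarrow> 'a rel \<Rightarrow> nat \<Rightarrow> bool" where
  "is_min_size V E F k \<longleftrightarrow>
     (\<exists>S. geodetic V E F S \<and> card S = k) \<and> (\<forall>S. geodetic V E F S \<longrightarrow> k \<le> card S)"

lemma walk_through_edge:
  assumes "(u, a) \<in> E ^^ i" "(a, b) \<in> E" "(b, v) \<in> E ^^ j"
  shows "(u, v) \<in> E ^^ Suc (i + j)"
proof -
  have "(u, b) \<in> E ^^ Suc i"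
    using assms(1,2) by auto
  then have "(u, v) \<in> E ^^ (Suc i + j)"
    using assms(3) by (metis relpow_add relcompI)
  then show ?thesis by simp
qed

lemma relpow_subset_mono: "A \<subseteq> B \<Longrightarrow> A ^^ k \<subseteq> B ^^ k" for A B :: "'a rel"
  by (induction k) (simp_all add: relcomp_mono)

lemma walk_dist_relpow: "(u, v) \<in> E\<^sup>* \<Longrightarrow> (u, v) \<in> E ^^ walk_dist E u v"
  unfolding walk_dist_def by (rule LeastI_ex) (simp add: rtrancl_power[symmetric])

lemma walk_dist_le: "(u, v) \<in> E ^^ k \<Longrightarrow> walk_dist E u v \<le> k"
  unfolding walk_dist_def by (rule Least_le)

lemma walk_dist_eqI:
  "(u, v) \<in> E ^^ d \<Longrightarrow> (\<And>k. (u, v) \<in> E ^^ k \<Longrightarrow> d \<le> k) \<Longrightarrow> walk_dist E u v = d"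
  unfolding walk_dist_def by (rule Least_equality)

lemma geodesic_edgeI:
  assumes "(a, b) \<in> E" "(u, a) \<in> E ^^ i" "(b, v) \<in> E ^^ j"
    and "\<And>k. (u, v) \<in> E ^^ k \<Longrightarrow> i + j < k"
  shows "geodesic_edge E u v (a, b)"
  using assms unfolding geodesic_edge_def by force

lemma geodesic_edgeE:
  assumes "geodesic_edge E u v (a, b)"
  obtains i j where "(a, b) \<in> E" "(u, a) \<in> E ^^ i" "(b, v) \<in> E ^^ j"
    "\<And>k. (u, v) \<in> E ^^ k \<Longrightarrow> i + j < k"
proof -
  from assms obtain i j where "(a, b) \<in> E" "(u, a) \<in> E ^^ i" "(b, v) \<in> E ^^ j"
    "\<forall>k. (u, v) \<in> E ^^ k \<longrightarrow> i + j < k"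
    unfolding geodesic_edge_def by auto
  then show thesis by (intro that) auto
qed

lemma geodeticD:
  assumes "geodetic V E F S" "e \<in> E"
  obtains u v where "u \<in> S" "v \<in> S" "(u, v) \<notin> F" "geodesic_edge E u v e"
  using assms unfolding geodetic_def by blast

lemma geodetic_antimono: "geodetic V E F S \<Longrightarrow> F' \<subseteq> F \<Longrightarrow> geodetic V E F' S"
  unfolding geodetic_def by blast

lemma is_min_sizeI:
  "geodetic V E F S \<Longrightarrow> card S = k \<Longrightarrow> (\<And>T. geodetic V E F T \<Longrightarrow> k \<le> card T) \<Longrightarrow> is_min_size V E F k"
  unfolding is_min_size_def by blast

lemma is_min_sizeE:
  assumes "is_min_size V E F k"
  obtains S where "geodetic V E F S" "card S = k"
  using assms unfolding is_min_size_def by blast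

lemma is_min_size_le: "is_min_size V E F k \<Longrightarrow> geodetic V E F S \<Longrightarrow> k \<le> card S"
  unfolding is_min_size_def by blast

lemma is_min_size_unique: "is_min_size V E F k \<Longrightarrow> is_min_size V E F l \<Longrightarrow> k = l"
  by (metis is_min_size_def le_antisym)

lemma is_min_size_Least:
  assumes "geodetic V E F S"
  shows "is_min_size V E F (LEAST k. \<exists>S. geodetic V E F S \<and> card S = k)"
proof -
  define P where "P k \<longleftrightarrow> (\<exists>S. geodetic V E F S \<and> card S = k)" for k
  have "P (card S)" using assms unfolding P_def by blast
  then have "P (LEAST k. P k)" by (rule LeastI)
  moreover have "(LEAST k. P k) \<le> card S" if "geodetic V E F S" for S
    using that by (intro Least_le) (auto simp: P_def)
  ultimately show ?thesis unfolding is_min_size_def P_def by blast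
qed

section \<open>Reversal and renaming\<close>

text \<open>Reversing all edges exchanges the two terminals and the two parts of a series composition,
  so that every statement about the left part has a mirror image about the right part. Injective
  renaming is what the compositions do to the vertices of their second argument.\<close>

lemma relpow_converse_iff: "(x, y) \<in> (E\<inverse>) ^^ k \<longleftrightarrow> (y, x) \<in> E ^^ k"
  for E :: "'a rel"
proof -
  have "(y, x) \<in> R ^^ k" if "(x, y) \<in> (R\<inverse>) ^^ k" for R :: "'a rel" and x y
    using that
  proof (induction k arbitrary: y)
    case (Suc k)
    then obtain z where "(z, x) \<in> R ^^ k" "(y, z) \<in> R" by auto
    then show ?case by (rule relpow_Suc_I2[rotated])
  qed simp
  from this[of x y E] this[of y x "E\<inverse>"] show ?thesis by auto
qed

lemma geodesic_edge_converse:
  "geodesic_edge (E\<inverse>) v u (b, a) \<longleftrightarrow> geodesic_edge E u v (a, b)"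
  unfolding geodesic_edge_def by (subst ex_comm) (simp add: relpow_converse_iff conj_ac add.commute)

lemma geodetic_converse: "geodetic V (E\<inverse>) (F\<inverse>) S \<longleftrightarrow> geodetic V E F S"
proof -
  have "(\<forall>e\<in>E\<inverse>. \<exists>u\<in>S. \<exists>v\<in>S. (u, v) \<notin> F\<inverse> \<and> geodesic_edge (E\<inverse>) u v e) \<longleftrightarrow>
      (\<forall>(a, b)\<in>E. \<exists>v\<in>S. \<exists>u\<in>S. (u, v) \<notin> F \<and> geodesic_edge E u v (a, b))"
    by (force simp: geodesic_edge_converse)
  then show ?thesis unfolding geodetic_def by (auto 0 3)
qed

lemma is_min_size_converse: "is_min_size V (E\<inverse>) (F\<inverse>) k \<longleftrightarrow> is_min_size V E F k"
  unfolding is_min_size_def geodetic_converse ..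

context
  fixes f :: "'a \<Rightarrow> 'b" and V :: "'a set" and E :: "'a rel"
  assumes inj: "inj_on f V" and EV: "E \<subseteq> V \<times> V"
begin

lemma relpow_image_iff:
  assumes "x \<in> V" "y \<in> V"
  shows "(f x, f y) \<in> (map_prod f f ` E) ^^ k \<longleftrightarrow> (x, y) \<in> E ^^ k"
proof
  show "(x, y) \<in> E ^^ k \<Longrightarrow> (f x, f y) \<in> (map_prod f f ` E) ^^ k"
    by (induction k arbitrary: y) auto
  show "(f x, f y) \<in> (map_prod f f ` E) ^^ k \<Longrightarrow> (x, y) \<in> E ^^ k"
    using assms(2)
  proof (induction k arbitrary: y)
    case 0
    then show ?case using inj assms(1) by (auto dest: inj_onD)
  next
    case (Suc k)
    then obtain a b where "(f x, f a) \<in> (map_prod f f ` E) ^^ k" "(a, b) \<in> E" "f b = f y"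
      by auto
    moreover have "b = y" "a \<in> V"
      using calculation EV Suc.prems(2) inj by (auto dest: inj_onD)
    ultimately show ?case using Suc.IH by auto
  qed
qed

lemma walk_dist_image:
  "x \<in> V \<Longrightarrow> y \<in> V \<Longrightarrow> walk_dist (map_prod f f ` E) (f x) (f y) = walk_dist E x y"
  unfolding walk_dist_def by (simp add: relpow_image_iff)

lemma mem_image_iff:
  "x \<in> V \<Longrightarrow> y \<in> V \<Longrightarrow> R \<subseteq> V \<times> V \<Longrightarrow> (f x, f y) \<in> map_prod f f ` R \<longleftrightarrow> (x, y) \<in> R"
  using inj by (auto dest: inj_onD) 

lemma geodesic_edge_image:
  assumes "u \<in> V" "v \<in> V" "a \<in> V" "b \<in> V"
  shows "geodesic_edge (map_prod f f ` E) (f u) (f v) (f a, f b) \<longleftrightarrow> geodesic_edge E u v (a, b)"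
  unfolding geodesic_edge_def using assms mem_image_iff[OF _ _ EV] by (simp add: relpow_image_iff)

lemma geodetic_image:
  assumes "S \<subseteq> V" "F \<subseteq> V \<times> V"
  shows "geodetic (f ` V) (map_prod f f ` E) (map_prod f f ` F) (f ` S) \<longleftrightarrow> geodetic V E F S"
proof -
  have "(\<exists>u\<in>f ` S. \<exists>v\<in>f ` S. (u, v) \<notin> map_prod f f ` F \<and> geodesic_edge (map_prod f f ` E) u v (map_prod f f e))
    \<longleftrightarrow> (\<exists>u\<in>S. \<exists>v\<in>S. (u, v) \<notin> F \<and> geodesic_edge E u v e)" if "e \<in> E" for e
  proof -
    obtain a b where ab: "e = (a, b)" by (cases e)
    then have e: "e = (a, b)" "a \<in> V" "b \<in> V" using that EV by auto
    have "(f u, f v) \<notin> map_prod f f ` F \<and> geodesic_edge (map_prod f f ` E) (f u) (f v) (f a, f b)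
      \<longleftrightarrow> (u, v) \<notin> F \<and> geodesic_edge E u v (a, b)" if "u \<in> S" "v \<in> S" for u v
      using that assms e by (simp add: geodesic_edge_image mem_image_iff subset_iff)
    then show ?thesis unfolding e by simp
  qed
  moreover have "f ` S \<subseteq> f ` V" using assms by auto
  ultimately show ?thesis unfolding geodetic_def using assms by simp
qed

lemma is_min_size_image:
  assumes "F \<subseteq> V \<times> V"
  shows "is_min_size (f ` V) (map_prod f f ` E) (map_prod f f ` F) k \<longleftrightarrow> is_min_size V E F k"
proof -
  have sub: "S \<subseteq> V" if "geodetic V E F S" for S
    using that by (simp add: geodetic_def)
  have card: "card (f ` S) = card S" if "S \<subseteq> V" for S
    using that inj by (meson card_image inj_on_subset)
  have "(\<exists>S. geodetic (f ` V) (map_prod f f ` E) (map_prod f f ` F) S \<and> P (card S))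
      \<longleftrightarrow> (\<exists>S. geodetic V E F S \<and> P (card S))" for P
  proof
    assume "\<exists>S. geodetic (f ` V) (map_prod f f ` E) (map_prod f f ` F) S \<and> P (card S)"
    then obtain S where S: "geodetic (f ` V) (map_prod f f ` E) (map_prod f f ` F) S" "P (card S)"
      by blast
    then obtain T where "T \<subseteq> V" "S = f ` T"
      by (auto simp: geodetic_def subset_image_iff)
    with S show "\<exists>S. geodetic V E F S \<and> P (card S)"
      using geodetic_image[OF _ assms] card by auto
  next
    assume "\<exists>S. geodetic V E F S \<and> P (card S)"
    then show "\<exists>S. geodetic (f ` V) (map_prod f f ` E) (map_prod f f ` F) S \<and> P (card S)"
      using geodetic_image[OF _ assms] card sub by metis
  qed
  from this[of "\<lambda>c. c = k"] this[of "\<lambda>c. \<not> k \<le> c"] show ?thesis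
    unfolding is_min_size_def by blast
qed

end

section \<open>Two-terminal networks\<close>

text \<open>The properties of series-parallel digraphs on which the whole computation rests. They are
  inherited by both compositions, so no induction over the construction is required beyond
  establishing them.\<close>

locale two_terminal =
  fixes V :: "'a set" and E :: "'a rel" and s t :: 'a
  assumes finite_V: "finite V"
    and E_sub: "E \<subseteq> V \<times> V"
    and s_in: "s \<in> V" and t_in: "t \<in> V" and s_ne_t: "s \<noteq> t"
    and no_loop: "(v, v) \<notin> E"
    and no_in: "(v, s) \<notin> E"
    and no_out: "(t, v) \<notin> E"
    and from_s: "v \<in> V \<Longrightarrow> (s, v) \<in> E\<^sup>*"
    and to_t: "v \<in> V \<Longrightarrow> (v, t) \<in> E\<^sup>*"
begin

lemma converse_two_terminal: "two_terminal V (E\<inverse>) t s"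
  using finite_V E_sub s_in t_in s_ne_t no_loop no_in no_out from_s to_t
  by unfold_locales (auto simp: rtrancl_converse)

lemma walk_to_source: "(u, s) \<in> E ^^ i \<Longrightarrow> i = 0 \<and> u = s"
  using no_in by (cases i) auto

lemma walk_from_target: "(t, v) \<in> E ^^ i \<Longrightarrow> i = 0 \<and> v = t"
  using no_out by (cases i) (auto elim: relpow_Suc_E2 simp del: relpow.simps(2))

lemma walk_in_V: "(u, v) \<in> E ^^ k \<Longrightarrow> u \<in> V \<longleftrightarrow> v \<in> V"
  using E_sub by (induction k arbitrary: v) auto

lemma edge_in_V: "(a, b) \<in> E \<Longrightarrow> a \<in> V \<and> b \<in> V"
  using E_sub by auto

lemma geodesic_edge_ends:
  assumes "geodesic_edge E u v (a, b)"
  shows "u \<in> V" "v \<in> V" "u \<noteq> v" "v \<noteq> s" "u \<noteq> t"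
proof -
  obtain i j where *: "(a, b) \<in> E" "(u, a) \<in> E ^^ i" "(b, v) \<in> E ^^ j"
    "\<And>k. (u, v) \<in> E ^^ k \<Longrightarrow> i + j < k"
    using assms by (rule geodesic_edgeE) (rule that)
  show "u \<in> V" "v \<in> V"
    using * walk_in_V E_sub by auto
  show "u \<noteq> v" using *(4)[of 0] by auto
  show "v \<noteq> s" using walk_to_source[of b j] * no_in by auto
  show "u \<noteq> t" using walk_from_target[of a i] * no_out by auto
qed

lemma edge_out_of_source: obtains w where "(s, w) \<in> E"
  using from_s[OF t_in] s_ne_t by (meson converse_rtranclE)

text \<open>Nothing enters the source, so a walk through an edge leaving the source has to start there.\<close>

lemma geodetic_source: "geodetic V E F S \<Longrightarrow> s \<in> S"
proof -
  assume S: "geodetic V E F S"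
  obtain w where "(s, w) \<in> E" by (rule edge_out_of_source)
  then obtain u v where "u \<in> S" "geodesic_edge E u v (s, w)" using S by (elim geodeticD)
  then show "s \<in> S" using walk_to_source by (elim geodesic_edgeE) blast
qed

lemma geodetic_finite: "geodetic V E F S \<Longrightarrow> finite S"
  using finite_V finite_subset unfolding geodetic_def by blast

lemma geodetic_sub: "geodetic V E F S \<Longrightarrow> S \<subseteq> V"
  unfolding geodetic_def by blast

lemma edge_geodesic: "(a, b) \<in> E \<Longrightarrow> geodesic_edge E a b (a, b)"
  using no_loop by (intro geodesic_edgeI[where i = 0 and j = 0]) (auto intro: Suc_leI gr0I)

lemma geodetic_all: "E \<inter> F = {} \<Longrightarrow> geodetic V E F V"
  unfolding geodetic_def using edge_geodesic E_sub by fast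

lemma geodesic_source_target_edge:
  "geodesic_edge E u v (s, t) \<Longrightarrow> u = s \<and> v = t"
  by (elim geodesic_edgeE) (auto dest: walk_to_source walk_from_target)

text \<open>An edge from source to target lies on no walk but those between the terminals, which a
  closed set may not use. If there is no such edge, then the set of all vertices is closed, because
  every edge is a shortest walk between its own end points.\<close>

lemma geodetic_closed_iff: "(\<exists>S. geodetic V E {(s, t)} S) \<longleftrightarrow> (s, t) \<notin> E"
proof
  assume "\<exists>S. geodetic V E {(s, t)} S"
  then show "(s, t) \<notin> E" by (metis geodeticD geodesic_source_target_edge singletonI)
qed (use geodetic_all[of "{(s, t)}"] in auto)

text \<open>A closed set cannot consist of the two terminals alone, since no pair of end points would
  be left. The additional vertex is the one to which shortest paths are prolonged in a series
  composition.\<close>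

lemma geodetic_closed_extra:
  assumes "geodetic V E {(s, t)} S"
  shows "S - {s, t} \<noteq> {}"
proof -
  obtain w where "(s, w) \<in> E" by (rule edge_out_of_source)
  then obtain u v where *: "u \<in> S" "v \<in> S" "(u, v) \<noteq> (s, t)" "geodesic_edge E u v (s, w)"
    using assms by (elim geodeticD) auto
  show ?thesis using * geodesic_edge_ends[OF *(4)] by auto
qed

lemma walk_dist_pos: "0 < walk_dist E s t"
  using walk_dist_relpow[OF from_s[OF t_in]] s_ne_t by (cases "walk_dist E s t") auto

end

lemma (in two_terminal) geodetic_target: "geodetic V E F S \<Longrightarrow> t \<in> S"
  using two_terminal.geodetic_source[OF converse_two_terminal, of "F\<inverse>"] geodetic_converse by blast

lemma (in two_terminal) geodetic_card: "geodetic V E F S \<Longrightarrow> 2 \<le> card S"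
  using geodetic_source geodetic_target geodetic_finite s_ne_t
  by (metis card_2_iff card_mono empty_subsetI insert_subset)

lemma (in two_terminal) image_two_terminal:
  assumes inj: "inj_on f V"
  shows "two_terminal (f ` V) (map_prod f f ` E) (f s) (f t)"
proof
  have iff: "(f x, f y) \<in> map_prod f f ` E \<longleftrightarrow> (x, y) \<in> E" if "x \<in> V" "y \<in> V" for x y
    using mem_image_iff[OF inj E_sub that E_sub] .
  have rtr: "(f x, f y) \<in> (map_prod f f ` E)\<^sup>*" if "(x, y) \<in> E\<^sup>*" for x y
    using that by (induction rule: rtrancl_induct) (auto intro: rtrancl_into_rtrancl)
  show "finite (f ` V)" "map_prod f f ` E \<subseteq> f ` V \<times> f ` V" "f s \<in> f ` V" "f t \<in> f ` V" "f s \<noteq> f t"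
    using finite_V E_sub s_in t_in s_ne_t inj by (auto dest: inj_onD)
  show "(v, v) \<notin> map_prod f f ` E" "(v, f s) \<notin> map_prod f f ` E" "(f t, v) \<notin> map_prod f f ` E" for v
    using no_loop no_in no_out iff s_in t_in E_sub inj by (auto dest!: inj_onD[OF inj])
  show "(f s, v) \<in> (map_prod f f ` E)\<^sup>*" "(v, f t) \<in> (map_prod f f ` E)\<^sup>*" if "v \<in> f ` V" for v
    using that from_s to_t rtr by auto
qed

section \<open>Series composition\<close>

text \<open>The two parts share the vertex \<^term>\<open>c\<close> instead of having disjoint vertex sets that
  are merged afterwards. Then the composition is a plain union of edge relations.\<close>

locale series_glue =
  left: two_terminal V E s c + right: two_terminal V' E' c t
  for V E s c V' E' t +
  assumes meet: "V \<inter> V' = {c}"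
begin

abbreviation H where "H \<equiv> E \<union> E'"

lemma converse_glue: "series_glue V' (E'\<inverse>) t c V (E\<inverse>) s"
  using left.converse_two_terminal right.converse_two_terminal meet
  by (simp add: series_glue_def series_glue_axioms_def Int_commute)

lemma shared: "x \<in> V \<Longrightarrow> x \<in> V' \<Longrightarrow> x = c"
  using meet by blast

lemma ends_not_shared: "t \<notin> V" "s \<notin> V'"
  using shared right.t_in right.s_ne_t left.s_in left.s_ne_t by blast+

text \<open>The only way from the right part to the left part is through \<^term>\<open>c\<close>, which no edge
  of the right part enters; so a walk ending in the left part has no edge in the right part.\<close>

lemma walk_into_left: "(u, v) \<in> H ^^ k \<Longrightarrow> v \<in> V \<Longrightarrow> (u, v) \<in> E ^^ k"
proof (induction k arbitrary: v)
  case (Suc k)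
  then obtain w where w: "(u, w) \<in> H ^^ k" "(w, v) \<in> H" by auto
  have "(w, v) \<notin> E'"
    using Suc.prems(2) right.edge_in_V[of w v] shared right.no_in[of w] by blast
  then have "(w, v) \<in> E" using w by auto
  then show ?case using Suc.IH[OF w(1)] left.edge_in_V by auto
qed simp

lemma left_walk_iff: "v \<in> V \<Longrightarrow> (u, v) \<in> H ^^ k \<longleftrightarrow> (u, v) \<in> E ^^ k"
  using walk_into_left relpow_subset_mono[of E H k] by blast

lemma crossing_walk:
  "(u, v) \<in> H ^^ k \<Longrightarrow> u \<in> V \<Longrightarrow> v \<in> V' \<Longrightarrow> \<exists>i j. k = i + j \<and> (u, c) \<in> E ^^ i \<and> (c, v) \<in> E' ^^ j"
proof (induction k arbitrary: v)
  case 0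
  then have "u = c" "v = c" using shared by auto
  then show ?case by auto
next
  case (Suc k)
  then obtain w where w: "(u, w) \<in> H ^^ k" "(w, v) \<in> H" by auto
  show ?case
  proof (cases "(w, v) \<in> E")
    case True
    then have "v = c" using left.edge_in_V Suc.prems shared by blast
    then have "(u, c) \<in> E ^^ Suc k"
      using Suc.prems(1) left_walk_iff[OF left.t_in, of u "Suc k"] by blast
    then show ?thesis using \<open>v = c\<close> by (intro exI[of _ "Suc k"] exI[of _ 0]) simp
  next
    case False
    then have wv: "(w, v) \<in> E'" using w by auto
    then have "w \<in> V'" using right.edge_in_V by auto
    from Suc.IH[OF w(1) Suc.prems(2) this] obtain i j where
      "k = i + j" "(u, c) \<in> E ^^ i" "(c, w) \<in> E' ^^ j" by auto
    then show ?thesis using wv by (intro exI[of _ i] exI[of _ "Suc j"]) auto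
  qed
qed

lemma crossing_walkI: "(u, c) \<in> E ^^ i \<Longrightarrow> (c, v) \<in> E' ^^ j \<Longrightarrow> (u, v) \<in> H ^^ (i + j)"
  using relpow_subset_mono[of E H i] relpow_subset_mono[of E' H j] by (blast intro: relpow_trans)

lemma series_walk_dist: "walk_dist H s t = walk_dist E s c + walk_dist E' c t"
proof (rule walk_dist_eqI)
  show "(s, t) \<in> H ^^ (walk_dist E s c + walk_dist E' c t)"
    using left.from_s[OF left.t_in] right.from_s[OF right.t_in]
    by (intro crossing_walkI walk_dist_relpow)
  show "walk_dist E s c + walk_dist E' c t \<le> k" if "(s, t) \<in> H ^^ k" for k
    using crossing_walk[OF that left.s_in right.t_in] walk_dist_le by (fastforce intro: add_mono)
qed

lemma series_two_terminal: "two_terminal (V \<union> V') H s t"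
proof
  show "finite (V \<union> V')" "H \<subseteq> (V \<union> V') \<times> (V \<union> V')" "s \<in> V \<union> V'" "t \<in> V \<union> V'" "s \<noteq> t"
    using left.finite_V right.finite_V left.E_sub right.E_sub left.s_in right.t_in ends_not_shared by auto
  show "(v, v) \<notin> H" "(v, s) \<notin> H" "(t, v) \<notin> H" for v
    using left.no_loop right.no_loop left.no_in right.no_out ends_not_shared left.edge_in_V right.edge_in_V
    by blast+
  have l: "(x, y) \<in> H\<^sup>*" if "(x, y) \<in> E\<^sup>*" for x y
    using that rtrancl_mono[of E H] by blast
  have r: "(x, y) \<in> H\<^sup>*" if "(x, y) \<in> E'\<^sup>*" for x y
    using that rtrancl_mono[of E' H] by blast
  show "(s, v) \<in> H\<^sup>*" if "v \<in> V \<union> V'" for v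
    using that l[OF left.from_s] r[OF right.from_s] l[OF left.from_s[OF left.t_in]] by (auto intro: rtrancl_trans)
  show "(v, t) \<in> H\<^sup>*" if "v \<in> V \<union> V'" for v
    using that l[OF left.to_t] r[OF right.to_t] r[OF right.from_s[OF right.t_in]] by (auto intro: rtrancl_trans)
qed

lemma geodesic_within_left: "v \<in> V \<Longrightarrow> geodesic_edge E u v e \<Longrightarrow> geodesic_edge H u v e"
  using relpow_subset_mono[of E H] unfolding geodesic_edge_def left_walk_iff by blast

text \<open>A shortest walk to the cut vertex stays shortest when prolonged by a shortest walk beyond
  it.\<close>

lemma geodesic_to_right:
  assumes "geodesic_edge E u c e" "v \<in> V'"
  shows "geodesic_edge H u v e"
proof (cases e)
  case (Pair a b)
  obtain i j where *: "(a, b) \<in> E" "(u, a) \<in> E ^^ i" "(b, c) \<in> E ^^ j"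
    "\<And>k. (u, c) \<in> E ^^ k \<Longrightarrow> i + j < k"
    using assms(1)[unfolded Pair] by (rule geodesic_edgeE) (rule that)
  let ?d = "walk_dist E' c v"
  have d: "(c, v) \<in> E' ^^ ?d"
    using assms right.from_s by (intro walk_dist_relpow)
  have u: "u \<in> V" using left.geodesic_edge_ends assms Pair by blast
  show ?thesis unfolding Pair
  proof (rule geodesic_edgeI)
    show "(a, b) \<in> H" using * by simp
    show "(u, a) \<in> H ^^ i" using *(2) relpow_subset_mono[of E H i] by blast
    show "(b, v) \<in> H ^^ (j + ?d)" using *(3) d by (rule crossing_walkI)
    show "i + (j + ?d) < k" if k: "(u, v) \<in> H ^^ k" for k
    proof -
      obtain p q where "k = p + q" "(u, c) \<in> E ^^ p" "(c, v) \<in> E' ^^ q"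
        using crossing_walk[OF k u assms(2)] by blast
      then show ?thesis using *(4)[of p] walk_dist_le[of c v q E'] by simp
    qed
  qed
qed

text \<open>Conversely, a shortest walk that leaves the left part passes through the cut vertex, and
  its initial part up to there is shortest.\<close>

lemma geodesic_trace_left:
  assumes "geodesic_edge H u v e" "e \<in> E"
  shows "u \<in> V" "v \<in> V \<and> geodesic_edge E u v e \<or> v \<in> V' - V \<and> geodesic_edge E u c e"
proof -
  obtain a b where e: "e = (a, b)" by (cases e)
  obtain i j where *: "(u, a) \<in> H ^^ i" "(b, v) \<in> H ^^ j"
    "\<And>k. (u, v) \<in> H ^^ k \<Longrightarrow> i + j < k"
    using assms(1) unfolding e by (rule geodesic_edgeE) (rule that)
  have ab: "(a, b) \<in> E" "a \<in> V" "b \<in> V" using assms(2) left.edge_in_V e by auto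
  have ua: "(u, a) \<in> E ^^ i" using *(1) ab left_walk_iff by blast
  then show u: "u \<in> V" using left.walk_in_V ab by blast
  have "v \<in> V \<union> V'" using two_terminal.geodesic_edge_ends(2)[OF series_two_terminal] assms e by blast
  moreover have "geodesic_edge E u v e" if v: "v \<in> V"
    using ab(1) ua *(2,3) left_walk_iff[OF v] unfolding e by (intro geodesic_edgeI) blast+
  moreover have "geodesic_edge E u c e" if v: "v \<in> V'"
  proof -
    obtain p q where pq: "j = p + q" "(b, c) \<in> E ^^ p" "(c, v) \<in> E' ^^ q"
      using crossing_walk[OF *(2) ab(3) v] by blast
    show ?thesis unfolding e
    proof (rule geodesic_edgeI[OF ab(1) ua pq(2)])
      show "i + p < k" if "(u, c) \<in> E ^^ k" for k
        using *(3)[OF crossing_walkI[OF that pq(3)]] pq(1) by simp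
    qed
  qed
  ultimately show "v \<in> V \<and> geodesic_edge E u v e \<or> v \<in> V' - V \<and> geodesic_edge E u c e" by blast
qed

text \<open>The cut vertex can be dropped from the glued set: a shortest walk ending in \<^term>\<open>c\<close> is
  prolonged to \<^term>\<open>t\<close>. This fails only if it started in \<^term>\<open>s\<close> and the pair
  \<^term>\<open>(s, t)\<close> is forbidden; then any further vertex of \<^term>\<open>T'\<close> serves as end point.\<close>

lemma extend_left_geodesic:
  assumes "T \<subseteq> V" "T' \<subseteq> V'" "t \<in> T'" "u \<in> T" "v \<in> T" "geodesic_edge E u v e"
    and F: "F \<subseteq> {(s, t)}" "F = {} \<or> (u, v) \<noteq> (s, c) \<or> T' - {c, t} \<noteq> {}"
  shows "\<exists>u\<in>T \<union> T' - {c}. \<exists>v\<in>T \<union> T' - {c}. (u, v) \<notin> F \<and> geodesic_edge H u v e"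
proof -
  have u: "u \<noteq> c" using left.geodesic_edge_ends assms(6) by (metis surj_pair)
  consider "v \<noteq> c" | "v = c" "F = {} \<or> u \<noteq> s" | y where "v = c" "y \<in> T'" "y \<noteq> c" "y \<noteq> t"
    using F(2) by blast
  then show ?thesis
  proof cases
    case 1
    have "v \<in> V" "v \<noteq> t" using assms(1,5) ends_not_shared by auto
    then show ?thesis using 1 u F(1) geodesic_within_left assms(4-6) by blast
  next
    case 2
    then have "geodesic_edge H u t e" using geodesic_to_right assms(6) right.t_in by blast
    then show ?thesis using 2 u F(1) assms(3,4) right.s_ne_t by blast
  next
    case 3
    then have "geodesic_edge H u y e" using geodesic_to_right assms(2,6) by blast
    then show ?thesis using 3 u F(1) assms(4) by blast
  qed
qed

lemma geodetic_glue:
  assumes T: "geodetic V E A T" and T': "geodetic V' E' A' T'" and F: "F \<subseteq> {(s, t)}"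
    and l: "F = {} \<or> (s, c) \<in> A \<or> T' - {c, t} \<noteq> {}"
    and r: "F = {} \<or> (c, t) \<in> A' \<or> T - {s, c} \<noteq> {}"
  shows "geodetic (V \<union> V') H F (T \<union> T' - {c})"
proof -
  interpret dual: series_glue V' "E'\<inverse>" t c V "E\<inverse>" s by (rule converse_glue)
  note sub = left.geodetic_sub[OF T] right.geodetic_sub[OF T']
  have ends: "s \<in> T" "t \<in> T'"
    using left.geodetic_source[OF T] right.geodetic_target[OF T'] by auto
  have H: "E'\<inverse> \<union> E\<inverse> = H\<inverse>" by auto
  have "\<exists>u\<in>T \<union> T' - {c}. \<exists>v\<in>T \<union> T' - {c}. (u, v) \<notin> F \<and> geodesic_edge H u v e" if "e \<in> H" for e
    using that
  proof
    assume "e \<in> E"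
    with T obtain u v where "u \<in> T" "v \<in> T" "(u, v) \<notin> A" "geodesic_edge E u v e"
      by (elim geodeticD)
    then show ?thesis using l by (intro extend_left_geodesic[OF sub ends(2) _ _ _ F]) auto
  next
    assume e: "e \<in> E'"
    obtain a b where ab: "e = (a, b)" by (cases e)
    from T' e obtain u v where *: "u \<in> T'" "v \<in> T'" "(u, v) \<notin> A'" "geodesic_edge E' u v e"
      by (elim geodeticD)
    have "\<exists>v\<in>T' \<union> T - {c}. \<exists>u\<in>T' \<union> T - {c}. (v, u) \<notin> F\<inverse> \<and> geodesic_edge (H\<inverse>) v u (b, a)"
      unfolding H[symmetric]
    proof (rule dual.extend_left_geodesic[OF sub(2,1) ends(1) *(2,1)])
      show "geodesic_edge (E'\<inverse>) v u (b, a)" using *(4) unfolding ab geodesic_edge_converse .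
      show "F\<inverse> \<subseteq> {(t, s)}" using F by auto
      show "F\<inverse> = {} \<or> (v, u) \<noteq> (t, c) \<or> T - {c, s} \<noteq> {}" using r *(3) by auto
    qed
    then show ?thesis unfolding ab geodesic_edge_converse by auto
  qed
  then show ?thesis using sub unfolding geodetic_def by blast
qed

lemma card_glue:
  assumes "T \<subseteq> V" "T' \<subseteq> V'" "c \<in> T" "c \<in> T'"
  shows "card T + card T' = card (T \<union> T') + 1" "card (T \<union> T') = card (T \<union> T' - {c}) + 1"
proof -
  have fin: "finite T" "finite T'"
    using assms left.finite_V right.finite_V finite_subset by blast+
  have "T \<inter> T' = {c}" using assms meet by auto
  then show "card T + card T' = card (T \<union> T') + 1"
    using card_Un_Int[OF fin] by simp
  show "card (T \<union> T') = card (T \<union> T' - {c}) + 1"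
    using fin assms by (subst card.remove[of _ c]) auto
qed

lemma card_geodetic_glue:
  assumes T: "geodetic V E A T" and T': "geodetic V' E' A' T'"
  shows "card (T \<union> T') = card T + card T' - 1" "card (T \<union> T' - {c}) = card T + card T' - 2"
  using card_glue[OF left.geodetic_sub[OF T] right.geodetic_sub[OF T']
      left.geodetic_target[OF T] right.geodetic_source[OF T']] by linarith+

text \<open>The trace on the left part has to be completed by \<^term>\<open>c\<close>, the end point that replaces
  all end points in the right part. The second premise says that this replacement turns no permitted
  pair of end points into a forbidden one.\<close>

lemma geodetic_trace_left:
  assumes S: "geodetic (V \<union> V') H F S"
    and A: "\<And>u v. u \<in> S \<Longrightarrow> v \<in> S \<Longrightarrow> (u, v) \<notin> F \<Longrightarrow>
      (u, if v \<in> V then v else c) \<notin> A"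
  shows "geodetic V E A (insert c (S \<inter> V))"
  unfolding geodetic_def
proof (intro conjI ballI)
  show "insert c (S \<inter> V) \<subseteq> V" using left.t_in by auto
  fix e assume e: "e \<in> E"
  then have "e \<in> H" by simp
  then obtain u v where *: "u \<in> S" "v \<in> S" "(u, v) \<notin> F" "geodesic_edge H u v e"
    using S by (elim geodeticD)
  show "\<exists>u\<in>insert c (S \<inter> V). \<exists>v\<in>insert c (S \<inter> V). (u, v) \<notin> A \<and> geodesic_edge E u v e"
    using geodesic_trace_left[OF *(4) e] A[OF *(1-3)] *(1,2) by (auto split: if_splits)
qed

lemma converse_series_geodetic:
  "geodetic (V' \<union> V) (E'\<inverse> \<union> E\<inverse>) (F\<inverse>) S \<longleftrightarrow> geodetic (V \<union> V') H F S"
  using geodetic_converse[of "V \<union> V'" H F S] by (simp add: Un_commute converse_Un)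

lemma geodetic_trace_right:
  assumes S: "geodetic (V \<union> V') H F S"
    and A: "\<And>u v. u \<in> S \<Longrightarrow> v \<in> S \<Longrightarrow> (u, v) \<notin> F \<Longrightarrow>
      (if u \<in> V' then u else c, v) \<notin> A"
  shows "geodetic V' E' A (insert c (S \<inter> V'))"
proof -
  interpret dual: series_glue V' "E'\<inverse>" t c V "E\<inverse>" s by (rule converse_glue)
  have "geodetic (V' \<union> V) (E'\<inverse> \<union> E\<inverse>) (F\<inverse>) S" using S by (simp only: converse_series_geodetic)
  then have "geodetic V' (E'\<inverse>) (A\<inverse>) (insert c (S \<inter> V'))"
    by (rule dual.geodetic_trace_left) (use A in auto)
  then show ?thesis by (simp only: geodetic_converse)
qed

text \<open>The two completed traces together count the cut vertex twice, whether or not it was in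
  \<^term>\<open>S\<close>. Compared with the sizes of the completed traces, a set that omits the cut
  vertex is thus one smaller than a set that contains it.\<close>

lemma card_trace:
  assumes "geodetic (V \<union> V') H F S"
  shows "card (insert c (S \<inter> V)) + card (insert c (S \<inter> V')) = card S + (if c \<in> S then 1 else 2)"
proof -
  have "S \<subseteq> V \<union> V'" using assms by (simp add: geodetic_def)
  then have "insert c (S \<inter> V) \<union> insert c (S \<inter> V') = insert c S" by auto
  moreover have "finite S" using two_terminal.geodetic_finite[OF series_two_terminal assms] .
  ultimately show ?thesis
    using card_glue(1)[of "insert c (S \<inter> V)" "insert c (S \<inter> V')"] left.t_in right.s_in
    by (auto simp: insert_absorb)
qed

theorem series_min_size:
  assumes m: "is_min_size V E {} m" and m': "is_min_size V' E' {} m'"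
  shows "is_min_size (V \<union> V') H {} (m + m' - 2)"
proof -
  obtain T T' where T: "geodetic V E {} T" "card T = m" and T': "geodetic V' E' {} T'" "card T' = m'"
    using m m' by (elim is_min_sizeE)
  show ?thesis
  proof (rule is_min_sizeI)
    show "geodetic (V \<union> V') H {} (T \<union> T' - {c})"
      using T T' by (intro geodetic_glue) auto
    show "card (T \<union> T' - {c}) = m + m' - 2"
      using card_geodetic_glue(2)[OF T(1) T'(1)] unfolding T(2) T'(2) .
    show "m + m' - 2 \<le> card S" if S: "geodetic (V \<union> V') H {} S" for S
    proof -
      have "m \<le> card (insert c (S \<inter> V))" "m' \<le> card (insert c (S \<inter> V'))"
        using is_min_size_le[OF m geodetic_trace_left[OF S]] is_min_size_le[OF m' geodetic_trace_right[OF S]]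
        by simp_all
      then show ?thesis using card_trace[OF S] by (simp split: if_splits)
    qed
  qed
qed

text \<open>If the right trace is \<^term>\<open>{t}\<close>, then \<^term>\<open>t\<close> is the only end point beyond the
  cut vertex, and forbidding \<^term>\<open>(s, t)\<close> in the composition amounts to forbidding
  \<^term>\<open>(s, c)\<close> in the left part.\<close>

lemma closed_trace_left:
  assumes S: "geodetic (V \<union> V') H {(s, t)} S" and "c \<notin> S" "S \<inter> V' = {t}"
  shows "geodetic V E {(s, c)} (insert c (S \<inter> V))"
proof (rule geodetic_trace_left[OF S])
  show "(u, if v \<in> V then v else c) \<notin> {(s, c)}" if "u \<in> S" "v \<in> S" "(u, v) \<notin> {(s, t)}" for u v
    using that assms S unfolding geodetic_def by auto
qed

lemma small_trace:
  assumes S: "geodetic (V \<union> V') H F S" and "c \<notin> S" and "card (insert c (S \<inter> V')) = 2"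
  shows "S \<inter> V' = {t}"
proof -
  have "t \<in> S" using two_terminal.geodetic_target[OF series_two_terminal S] .
  have "finite S" using two_terminal.geodetic_finite[OF series_two_terminal S] .
  then have "card (S \<inter> V') = 1" using assms by simp
  then show ?thesis using \<open>t \<in> S\<close> right.t_in by (metis IntI card_1_singletonE singletonD)
qed

lemma small_closed_left:
  assumes m: "is_min_size V E {} m" and S: "geodetic (V \<union> V') H {(s, t)} S" and "c \<notin> S"
    and "card (insert c (S \<inter> V)) = m" "card (insert c (S \<inter> V')) = 2"
  shows "is_min_size V E {(s, c)} m"
proof (rule is_min_sizeI)
  show "geodetic V E {(s, c)} (insert c (S \<inter> V))"
    using closed_trace_left[OF S] small_trace[OF S] assms by blast
  show "card (insert c (S \<inter> V)) = m" by fact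
  show "m \<le> card T" if "geodetic V E {(s, c)} T" for T
    using is_min_size_le[OF m geodetic_antimono[OF that]] by simp
qed

lemma small_closed_right:
  assumes m: "is_min_size V' E' {} m" and S: "geodetic (V \<union> V') H {(s, t)} S" and "c \<notin> S"
    and "card (insert c (S \<inter> V')) = m" "card (insert c (S \<inter> V)) = 2"
  shows "is_min_size V' E' {(c, t)} m"
proof -
  have flip: "{(x, y)}\<inverse> = {(y, x)}" for x y :: 'a by auto
  have "is_min_size V' (E'\<inverse>) {} m" using m is_min_size_converse[of V' E' "{}" m] by simp
  moreover have "geodetic (V' \<union> V) (E'\<inverse> \<union> E\<inverse>) {(t, s)} S"
    using S converse_series_geodetic[of "{(s, t)}" S] unfolding flip by blast
  ultimately have "is_min_size V' (E'\<inverse>) {(t, c)} m"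
    using assms(3-5) by (rule series_glue.small_closed_left[OF converse_glue])
  then show ?thesis using is_min_size_converse[of V' E' "{(c, t)}" m] unfolding flip by blast
qed

text \<open>If the condition holds, minimum sets of the parts can be glued without the cut vertex.
  Otherwise the cut vertex is kept as an end point, at the price of one vertex; a smaller closed set would avoid the cut vertex and have minimum traces, one of them of size two,
  so that the other part would have a closed set of minimum size.\<close>

theorem series_closed_min_size:
  assumes m: "is_min_size V E {} m" and m': "is_min_size V' E' {} m'"
  shows "is_min_size (V \<union> V') H {(s, t)}
    (if 2 < m \<and> 2 < m' \<or> is_min_size V E {(s, c)} m \<or> is_min_size V' E' {(c, t)} m'
     then m + m' - 2 else m + m' - 1)"
proof -
  have lower: "m \<le> card (insert c (S \<inter> V))" "m' \<le> card (insert c (S \<inter> V'))"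
    if S: "geodetic (V \<union> V') H {(s, t)} S" for S
    using is_min_size_le[OF m] is_min_size_le[OF m']
      geodetic_trace_left[OF S, of "{}"] geodetic_trace_right[OF S, of "{}"] by blast+
  have lower': "m + m' - 2 \<le> card S" if S: "geodetic (V \<union> V') H {(s, t)} S" for S
    using lower[OF S] card_trace[OF S] by (simp split: if_splits)
  have glue: "is_min_size (V \<union> V') H {(s, t)} (m + m' - 2)"
    if T: "geodetic V E A T" "card T = m" and T': "geodetic V' E' A' T'" "card T' = m'"
      and "(s, c) \<in> A \<or> T' - {c, t} \<noteq> {}" "(c, t) \<in> A' \<or> T - {s, c} \<noteq> {}" for A T A' T'
  proof (rule is_min_sizeI[OF _ _ lower'])
    show "geodetic (V \<union> V') H {(s, t)} (T \<union> T' - {c})"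
      using that by (intro geodetic_glue[OF T(1) T'(1)]) auto
    show "card (T \<union> T' - {c}) = m + m' - 2"
      using card_geodetic_glue(2)[OF T(1) T'(1)] unfolding T(2) T'(2) .
  qed
  have big: "X - {x, y} \<noteq> {}" if "2 < card X" for X :: "'a set" and x y
  proof
    assume "X - {x, y} = {}"
    then have "card X \<le> card {x, y}" by (intro card_mono) auto
    also have "\<dots> \<le> 2" by (simp add: card_insert_le_m1)
    finally show False using that by simp
  qed
  obtain T T' where T: "geodetic V E {} T" "card T = m" and T': "geodetic V' E' {} T'" "card T' = m'"
    using m m' by (elim is_min_sizeE)
  consider "2 < m" "2 < m'" | "is_min_size V E {(s, c)} m" | "is_min_size V' E' {(c, t)} m'"
    | "\<not> (2 < m \<and> 2 < m')" "\<not> is_min_size V E {(s, c)} m" "\<not> is_min_size V' E' {(c, t)} m'"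
    by blast
  then show ?thesis
  proof cases
    case 1
    then have "is_min_size (V \<union> V') H {(s, t)} (m + m' - 2)"
      using T(2) T'(2) by (intro glue[OF T T'] disjI2 big) simp_all
    with 1 show ?thesis by simp
  next
    case 2
    then obtain U where U: "geodetic V E {(s, c)} U" "card U = m" by (elim is_min_sizeE)
    have "is_min_size (V \<union> V') H {(s, t)} (m + m' - 2)"
      using left.geodetic_closed_extra[OF U(1)] by (intro glue[OF U T']) auto
    with 2 show ?thesis by simp
  next
    case 3
    then obtain U where U: "geodetic V' E' {(c, t)} U" "card U = m'" by (elim is_min_sizeE)
    have "is_min_size (V \<union> V') H {(s, t)} (m + m' - 2)"
      using right.geodetic_closed_extra[OF U(1)] by (intro glue[OF T U]) auto
    with 3 show ?thesis by simp
  next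
    case 4
    have "is_min_size (V \<union> V') H {(s, t)} (m + m' - 1)"
    proof (rule is_min_sizeI)
      \<comment> \<open>With \<^term>\<open>c\<close> available, every pair of end points stays within one part, and no part
        contains both \<^term>\<open>s\<close> and \<^term>\<open>t\<close>.\<close>
      show "geodetic (V \<union> V') H {(s, t)} (T \<union> T')"
        unfolding geodetic_def
      proof (intro conjI ballI)
        show "T \<union> T' \<subseteq> V \<union> V'"
          using T T' unfolding geodetic_def by blast
        interpret dual: series_glue V' "E'\<inverse>" t c V "E\<inverse>" s by (rule converse_glue)
        have H: "E'\<inverse> \<union> E\<inverse> = H\<inverse>" by auto
        fix e assume "e \<in> H"
        then show "\<exists>u\<in>T \<union> T'. \<exists>v\<in>T \<union> T'. (u, v) \<notin> {(s, t)} \<and> geodesic_edge H u v e"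
        proof
          assume "e \<in> E"
          with T obtain u v where *: "u \<in> T" "v \<in> T" "geodesic_edge E u v e" by (elim geodeticD)
          then have "v \<in> V" using left.geodetic_sub[OF T(1)] by auto
          then have "geodesic_edge H u v e" "v \<noteq> t"
            using * geodesic_within_left ends_not_shared by blast+
          then show ?thesis using *(1,2) by blast
        next
          assume e: "e \<in> E'"
          obtain a b where ab: "e = (a, b)" by (cases e)
          from T' e obtain u v where *: "u \<in> T'" "v \<in> T'" "geodesic_edge E' u v e" by (elim geodeticD)
          then have "u \<in> V'" using right.geodetic_sub[OF T'(1)] by auto
          then have "geodesic_edge H u v e" "u \<noteq> s"
            using * dual.geodesic_within_left[of u v "(b, a)"] ends_not_shared
            unfolding H ab geodesic_edge_converse by auto
          then show ?thesis using *(1,2) by blast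
        qed
      qed
      show "card (T \<union> T') = m + m' - 1"
        using card_geodetic_glue(1)[OF T(1) T'(1)] unfolding T(2) T'(2) .
      show "m + m' - 1 \<le> card S" if S: "geodetic (V \<union> V') H {(s, t)} S" for S
      proof (rule ccontr)
        assume "\<not> m + m' - 1 \<le> card S"
        then have c: "c \<notin> S" and eq: "card (insert c (S \<inter> V)) = m" "card (insert c (S \<inter> V')) = m'"
          using lower[OF S] card_trace[OF S] by (auto split: if_splits)
        have "m = 2 \<or> m' = 2"
          using 4(1) left.geodetic_card[OF T(1)] right.geodetic_card[OF T'(1)] T T' by linarith
        then show False
          using small_closed_left[OF m S c eq(1)] small_closed_right[OF m' S c eq(2)] eq 4 by auto
      qed
    qed
    with 4 show ?thesis by (simp only: if_False de_Morgan_disj simp_thms)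
  qed
qed

end

section \<open>Parallel composition\<close>

text \<open>Again the parts share vertices, here both terminals. An edge between the terminals may
  belong to both parts.\<close>

locale parallel_glue =
  left: two_terminal V E s t + right: two_terminal V' E' s t
  for V E s t V' E' +
  assumes meet: "V \<inter> V' = {s, t}"
begin

abbreviation H where "H \<equiv> E \<union> E'"

lemma swapped_glue: "parallel_glue V' E' s t V E"
  using left.two_terminal_axioms right.two_terminal_axioms meet
  by (simp add: parallel_glue_def parallel_glue_axioms_def Int_commute)

lemma shared: "x \<in> V \<Longrightarrow> x \<in> V' \<Longrightarrow> x = s \<or> x = t"
  using meet by blast

lemma no_switch: "\<not> ((x, w) \<in> E \<and> (w, v) \<in> E')" "\<not> ((x, w) \<in> E' \<and> (w, v) \<in> E)"
  using shared[of w] left.edge_in_V right.edge_in_V left.no_in left.no_out right.no_in right.no_out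
  by blast+

text \<open>A walk could change parts only at a terminal in its interior, but there is none:
  the source is never entered and the target never left.\<close>

lemma walk_split: "(u, v) \<in> H ^^ k \<longleftrightarrow> (u, v) \<in> E ^^ k \<or> (u, v) \<in> E' ^^ k"
proof
  show "(u, v) \<in> H ^^ k \<Longrightarrow> (u, v) \<in> E ^^ k \<or> (u, v) \<in> E' ^^ k"
  proof (induction k arbitrary: v)
    case (Suc k)
    then obtain w where w: "(u, w) \<in> E ^^ k \<or> (u, w) \<in> E' ^^ k" "(w, v) \<in> H" by auto
    show ?case
    proof (cases k)
      case 0
      then show ?thesis using w by auto
    next
      case (Suc l)
      then have "(u, w) \<in> E ^^ k \<and> (w, v) \<in> E \<or> (u, w) \<in> E' ^^ k \<and> (w, v) \<in> E'"
        using w no_switch unfolding Suc by auto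
      then show ?thesis by auto
    qed
  qed simp
  show "(u, v) \<in> E ^^ k \<or> (u, v) \<in> E' ^^ k \<Longrightarrow> (u, v) \<in> H ^^ k"
    using relpow_subset_mono[of E H k] relpow_subset_mono[of E' H k] by blast
qed

lemma parallel_walk_dist: "walk_dist H s t = min (walk_dist E s t) (walk_dist E' s t)"
proof (rule walk_dist_eqI)
  show "(s, t) \<in> H ^^ min (walk_dist E s t) (walk_dist E' s t)"
    using walk_dist_relpow[OF left.from_s[OF left.t_in]] walk_dist_relpow[OF right.from_s[OF right.t_in]]
    by (simp add: walk_split min_def)
  show "min (walk_dist E s t) (walk_dist E' s t) \<le> k" if "(s, t) \<in> H ^^ k" for k
    using that walk_dist_le[of s t k E] walk_dist_le[of s t k E'] by (auto simp: walk_split)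
qed

lemma parallel_two_terminal: "two_terminal (V \<union> V') H s t"
proof
  show "finite (V \<union> V')" "H \<subseteq> (V \<union> V') \<times> (V \<union> V')" "s \<in> V \<union> V'" "t \<in> V \<union> V'" "s \<noteq> t"
    using left.finite_V right.finite_V left.E_sub right.E_sub left.s_in right.t_in left.s_ne_t by auto
  show "(v, v) \<notin> H" "(v, s) \<notin> H" "(t, v) \<notin> H" for v
    using left.no_loop right.no_loop left.no_in left.no_out right.no_in right.no_out by blast+
  have l: "(x, y) \<in> H\<^sup>*" if "(x, y) \<in> E\<^sup>*" for x y
    using that rtrancl_mono[of E H] by blast
  have r: "(x, y) \<in> H\<^sup>*" if "(x, y) \<in> E'\<^sup>*" for x y
    using that rtrancl_mono[of E' H] by blast
  show "(s, v) \<in> H\<^sup>*" if "v \<in> V \<union> V'" for v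
    using that l[OF left.from_s] r[OF right.from_s] by blast
  show "(v, t) \<in> H\<^sup>*" if "v \<in> V \<union> V'" for v
    using that l[OF left.to_t] r[OF right.to_t] by blast
qed

text \<open>Walks between two vertices of one part stay in that part, unless they lead from source to
  target. Only for the latter does the other part compete, and it wins if it is strictly shorter.\<close>

lemma geodesic_edge_left_iff:
  assumes e: "e \<in> E"
  shows "geodesic_edge H u v e \<longleftrightarrow>
    geodesic_edge E u v e \<and> ((u, v) = (s, t) \<longrightarrow> walk_dist E s t \<le> walk_dist E' s t)"
proof -
  obtain a b where ab: "e = (a, b)" by (cases e)
  show ?thesis unfolding ab
  proof (intro iffI conjI impI; (elim conjE)?)
    assume g: "geodesic_edge H u v (a, b)"
    then obtain i j where *: "(u, a) \<in> H ^^ i" "(b, v) \<in> H ^^ j"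
      "\<And>k. (u, v) \<in> H ^^ k \<Longrightarrow> i + j < k"
      by (rule geodesic_edgeE) (rule that)
    have ua: "(u, a) \<in> E ^^ i"
      \<comment> \<open>The empty walk belongs to both parts. A nonempty walk to \<^term>\<open>a\<close> cannot be in the right
        part, since \<^term>\<open>(a, b)\<close> continues it in the left one.\<close>
    proof (cases i)
      case (Suc l)
      have "(u, a) \<notin> E' ^^ Suc l" using no_switch(2)[of _ a b] e ab by auto
      then show ?thesis using * Suc by (simp only: walk_split) blast
    qed (use * in simp)
    moreover have bv: "(b, v) \<in> E ^^ j"
    proof (cases j)
      case (Suc l)
      have "(b, v) \<notin> E' ^^ Suc l" using no_switch(1)[of a b] e ab relpow_Suc_D2[of b v l E'] by blast
      then show ?thesis using * Suc by (simp only: walk_split) blast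
    qed (use * in simp)
    moreover have "i + j < k" if "(u, v) \<in> E ^^ k" for k
      using that *(3) walk_split by blast
    ultimately show "geodesic_edge E u v (a, b)" using e ab by (intro geodesic_edgeI) auto
    assume st: "(u, v) = (s, t)"
    have "walk_dist E s t \<le> walk_dist H s t"
    proof -
      have "(s, t) \<in> E ^^ Suc (i + j)"
        using walk_through_edge[OF ua _ bv] e ab st by simp
      moreover have "i + j < walk_dist H s t"
        using *(3)[of "walk_dist H u v"] walk_dist_relpow[OF two_terminal.from_s[OF parallel_two_terminal]] st left.t_in by blast
      ultimately show ?thesis using walk_dist_le by (meson Suc_leI le_trans)
    qed
    then show "walk_dist E s t \<le> walk_dist E' s t" using parallel_walk_dist by simp
  next
    assume g: "geodesic_edge E u v (a, b)"
      and le: "(u, v) = (s, t) \<longrightarrow> walk_dist E s t \<le> walk_dist E' s t"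
    obtain i j where *: "(a, b) \<in> E" "(u, a) \<in> E ^^ i" "(b, v) \<in> E ^^ j"
      "\<And>k. (u, v) \<in> E ^^ k \<Longrightarrow> i + j < k"
      using g by (rule geodesic_edgeE) (rule that)
    note ends = left.geodesic_edge_ends[OF g]
    have "i + j < k" if "(u, v) \<in> E' ^^ k" for k
    proof (cases k)
      case 0
      then show ?thesis using that ends(3) by simp
    next
      case (Suc l)
      then have "u \<in> V'" "v \<in> V'"
        using that right.edge_in_V relpow_Suc_D2[of u v l E'] by auto
      then have st: "u = s" "v = t"
        using ends shared by blast+
      have "i + j < walk_dist E s t"
        using *(4) walk_dist_relpow[OF left.from_s[OF left.t_in]] st by blast
      also have "\<dots> \<le> walk_dist E' s t" using le st by simp
      also have "\<dots> \<le> k" using that st walk_dist_le[of s t k E'] by simp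
      finally show ?thesis .
    qed
    then show "geodesic_edge H u v (a, b)"
      using * by (intro geodesic_edgeI[where i = i and j = j]) (auto simp: walk_split)
  qed
qed

lemma geodesic_edge_right_iff:
  assumes e: "e \<in> E'"
  shows "geodesic_edge H u v e \<longleftrightarrow>
    geodesic_edge E' u v e \<and> ((u, v) = (s, t) \<longrightarrow> walk_dist E' s t \<le> walk_dist E s t)"
  using parallel_glue.geodesic_edge_left_iff[OF swapped_glue e] by (simp add: Un_commute)

text \<open>If the other part is strictly shorter, then no shortest path from source to target runs
  through this part, which has the same effect as forbidding the pair of terminals.\<close>

definition left_forbidden where
  "left_forbidden F = F \<union> (if walk_dist E' s t < walk_dist E s t then {(s, t)} else {})"

definition right_forbidden where
  "right_forbidden F = F \<union> (if walk_dist E s t < walk_dist E' s t then {(s, t)} else {})"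

lemma geodetic_parallel_iff:
  "geodetic (V \<union> V') H F S \<longleftrightarrow>
    S \<subseteq> V \<union> V' \<and> geodetic V E (left_forbidden F) (S \<inter> V) \<and> geodetic V' E' (right_forbidden F) (S \<inter> V')"
proof -
  have l: "(\<exists>u\<in>S. \<exists>v\<in>S. (u, v) \<notin> F \<and> geodesic_edge H u v e) \<longleftrightarrow>
    (\<exists>u\<in>S \<inter> V. \<exists>v\<in>S \<inter> V. (u, v) \<notin> left_forbidden F \<and> geodesic_edge E u v e)" if "e \<in> E" for e
  proof -
    have "(u, v) \<notin> F \<and> geodesic_edge H u v e \<longleftrightarrow>
      u \<in> V \<and> v \<in> V \<and> (u, v) \<notin> left_forbidden F \<and> geodesic_edge E u v e" for u v
      using left.geodesic_edge_ends(1,2)[of u v "fst e" "snd e"]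
      unfolding geodesic_edge_left_iff[OF that] left_forbidden_def by auto
    then show ?thesis by blast
  qed
  have r: "(\<exists>u\<in>S. \<exists>v\<in>S. (u, v) \<notin> F \<and> geodesic_edge H u v e) \<longleftrightarrow>
    (\<exists>u\<in>S \<inter> V'. \<exists>v\<in>S \<inter> V'. (u, v) \<notin> right_forbidden F \<and> geodesic_edge E' u v e)" if "e \<in> E'" for e
  proof -
    have "(u, v) \<notin> F \<and> geodesic_edge H u v e \<longleftrightarrow>
      u \<in> V' \<and> v \<in> V' \<and> (u, v) \<notin> right_forbidden F \<and> geodesic_edge E' u v e" for u v
      using right.geodesic_edge_ends(1,2)[of u v "fst e" "snd e"]
      unfolding geodesic_edge_right_iff[OF that] right_forbidden_def by auto
    then show ?thesis by blast
  qed
  show ?thesis unfolding geodetic_def using l r by (auto simp: ball_Un)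
qed

text \<open>Geodetic sets of the composition correspond to pairs of geodetic sets of the parts, and the
  two members of a pair have exactly the two terminals in common.\<close>

theorem parallel_min_size:
  assumes k: "is_min_size V E (left_forbidden F) k" and k': "is_min_size V' E' (right_forbidden F) k'"
  shows "is_min_size (V \<union> V') H F (k + k' - 2)"
proof -
  have card: "card S = card (S \<inter> V) + card (S \<inter> V') - 2"
    if S: "S \<subseteq> V \<union> V'" "s \<in> S" "t \<in> S" for S
  proof -
    have fin: "finite (S \<inter> V)" "finite (S \<inter> V')" using left.finite_V right.finite_V by auto
    have "(S \<inter> V) \<union> (S \<inter> V') = S" "(S \<inter> V) \<inter> (S \<inter> V') = {s, t}"
      using S meet by blast+
    then show ?thesis using card_Un_Int[OF fin] left.s_ne_t by simp
  qed
  obtain T T' where T: "geodetic V E (left_forbidden F) T" "card T = k"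
    and T': "geodetic V' E' (right_forbidden F) T'" "card T' = k'"
    using k k' by (elim is_min_sizeE)
  note sub = left.geodetic_sub[OF T(1)] right.geodetic_sub[OF T'(1)]
  have st: "{s, t} \<subseteq> T" "{s, t} \<subseteq> T'"
    using left.geodetic_source[OF T(1)] left.geodetic_target[OF T(1)]
      right.geodetic_source[OF T'(1)] right.geodetic_target[OF T'(1)] by auto
  have cap: "(T \<union> T') \<inter> V = T" "(T \<union> T') \<inter> V' = T'"
    using sub st by (auto dest: shared)
  show ?thesis
  proof (rule is_min_sizeI)
    show "geodetic (V \<union> V') H F (T \<union> T')"
      unfolding geodetic_parallel_iff cap using T(1) T'(1) sub by blast
    show "card (T \<union> T') = k + k' - 2"
      using card[of "T \<union> T'"] sub st unfolding cap T(2) T'(2) by blast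
    show "k + k' - 2 \<le> card S" if S: "geodetic (V \<union> V') H F S" for S
    proof -
      have S': "S \<subseteq> V \<union> V'" "geodetic V E (left_forbidden F) (S \<inter> V)"
        "geodetic V' E' (right_forbidden F) (S \<inter> V')"
        using S unfolding geodetic_parallel_iff by blast+
      have "s \<in> S" "t \<in> S"
        using left.geodetic_source[OF S'(2)] left.geodetic_target[OF S'(2)] by auto
      then have "card S = card (S \<inter> V) + card (S \<inter> V') - 2" using card[OF S'(1)] by blast
      then show ?thesis using is_min_size_le[OF k S'(2)] is_min_size_le[OF k' S'(3)] by simp
    qed
  qed
qed

end

section \<open>Series-parallel digraphs as two-terminal networks\<close>

context wf_digraph
begin

lemma awalk_relpow:
  "awalk u p v \<Longrightarrow> (u, v) \<in> arcs_ends G ^^ length p"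
proof (induction p arbitrary: u)
  case (Cons e p)
  then have "e \<in> arcs G" "u = tail G e" "(head G e, v) \<in> arcs_ends G ^^ length p"
    by (auto simp: awalk_Cons_iff)
  then show ?case unfolding length_Cons
    by (intro relpow_Suc_I2) (auto simp: arcs_ends_def arc_to_ends_def)
qed (simp add: awalk_Nil_iff)

lemma relpow_awalk:
  assumes "(u, v) \<in> arcs_ends G ^^ k" "v \<in> verts G"
  shows "\<exists>p. awalk u p v \<and> length p = k"
  using assms(1)
proof (induction k arbitrary: u)
  case 0
  then show ?case using assms(2) by (auto simp: awalk_Nil_iff)
next
  case (Suc k)
  then obtain w where w: "(u, w) \<in> arcs_ends G" "(w, v) \<in> arcs_ends G ^^ k"
    by (blast dest: relpow_Suc_D2)
  then obtain p where "awalk w p v" "length p = k" using Suc.IH by blast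
  moreover obtain e where "e \<in> arcs G" "tail G e = u" "head G e = w"
    using w(1) by (auto simp: arcs_ends_def arc_to_ends_def)
  ultimately show ?case by (intro exI[of _ "e # p"]) (auto simp: awalk_Cons_iff)
qed

text \<open>Cutting out a cycle would make a shortest walk shorter.\<close>

lemma shortest_awalk_is_apath:
  assumes "awalk u p v" "\<And>k. (u, v) \<in> arcs_ends G ^^ k \<Longrightarrow> length p \<le> k"
  shows "apath u p v"
proof -
  have "distinct (awalk_verts u p)"
  proof (rule ccontr)
    assume "\<not> distinct (awalk_verts u p)"
    from awalk_not_distinct_decomp[OF assms(1) this] obtain q r s where
      "p = q @ r @ s \<and> distinct (awalk_verts u q) \<and> 0 < length r \<and>
        (\<exists>w. awalk u q w \<and> awalk w r w \<and> awalk w s v)"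
      by (elim exE) (rule that)
    then have *: "p = q @ r @ s" "0 < length r" "\<exists>w. awalk u q w \<and> awalk w s v" by auto
    have "awalk u (q @ s) v" using *(3) by (elim exE conjE) (rule awalk_appendI)
    from assms(2)[OF awalk_relpow[OF this]] *(1,2) show False by simp
  qed
  then show ?thesis using assms(1) by (simp add: apath_def)
qed

lemma relpow_apath:
  assumes "(u, v) \<in> arcs_ends G ^^ k" "v \<in> verts G"
  shows "\<exists>p. apath u p v \<and> length p \<le> k"
proof -
  let ?d = "walk_dist (arcs_ends G) u v"
  have d: "(u, v) \<in> arcs_ends G ^^ ?d"
    using assms(1) by (intro walk_dist_relpow relpow_imp_rtrancl)
  obtain p where p: "awalk u p v" "length p = ?d" using relpow_awalk[OF d assms(2)] by blast
  then have "apath u p v" by (intro shortest_awalk_is_apath) (simp_all add: walk_dist_le)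
  then show ?thesis using p walk_dist_le[OF assms(1)] by auto
qed

end

lemma wf_graph_of:
  "parcs G \<subseteq> pverts G \<times> pverts G \<Longrightarrow> wf_digraph (graph_of G)"
  by unfold_locales (auto simp: pair_pre_digraph.truncate_def)

lemma truncate_simps [simp]:
  "pverts (pair_pre_digraph.truncate G) = pverts G"
  "parcs (pair_pre_digraph.truncate G) = parcs G"
  by (simp_all add: pair_pre_digraph.truncate_def)

context
  fixes G :: "'a st_digraph"
  assumes wf: "parcs G \<subseteq> pverts G \<times> pverts G"
begin

interpretation wf_digraph "graph_of G" by (rule wf_graph_of[OF wf])

lemma shortest_path_iff:
  "shortest_path G u p v \<longleftrightarrow>
    awalk u p v \<and> (\<forall>k. (u, v) \<in> parcs G ^^ k \<longrightarrow> length p \<le> k)"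
proof
  assume p: "shortest_path G u p v"
  then have a: "awalk u p v" unfolding shortest_path_def by (auto intro: awalkI_apath)
  have "length p \<le> k" if k: "(u, v) \<in> parcs G ^^ k" for k
  proof -
    obtain q where "apath u q v" "length q \<le> k"
      using relpow_apath[of u v k] k awalk_last_in_verts[OF a] by auto
    then show ?thesis using p unfolding shortest_path_def by (meson le_trans)
  qed
  with a show "awalk u p v \<and> (\<forall>k. (u, v) \<in> parcs G ^^ k \<longrightarrow> length p \<le> k)" by blast
next
  assume p: "awalk u p v \<and> (\<forall>k. (u, v) \<in> parcs G ^^ k \<longrightarrow> length p \<le> k)"
  then have "apath u p v" by (intro shortest_awalk_is_apath) auto
  moreover have "length p \<le> length q" if "apath u q v" for q
    using p awalk_relpow[OF awalkI_apath[OF that]] by simp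
  ultimately show "shortest_path G u p v" unfolding shortest_path_def by blast
qed

text \<open>In what follows, shortest paths occur only through \<^const>\<open>geodesic_edge\<close>: a path is split at
  the edge in one direction, and in the other the walk assembled around the edge is shortest, hence
  a path.\<close>

lemma edge_on_shortest_path_iff:
  "(\<exists>p. shortest_path G u p v \<and> e \<in> set p) \<longleftrightarrow> geodesic_edge (parcs G) u v e"
proof (cases e)
  case (Pair a b)
  show ?thesis unfolding Pair
  proof
    assume "\<exists>p. shortest_path G u p v \<and> (a, b) \<in> set p"
    then obtain p where p: "awalk u p v" "\<And>k. (u, v) \<in> parcs G ^^ k \<Longrightarrow> length p \<le> k" "(a, b) \<in> set p"
      unfolding shortest_path_iff by blast
    then obtain xs ys where xs: "p = xs @ (a, b) # ys" by (meson split_list)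
    then have w: "awalk u xs a" "awalk b ys v" "(a, b) \<in> parcs G"
      using p(1) by (auto simp: awalk_Cons_iff)
    show "geodesic_edge (parcs G) u v (a, b)"
      using awalk_relpow[OF w(1)] awalk_relpow[OF w(2)] w(3) p(2) xs
      by (intro geodesic_edgeI) fastforce+
  next
    assume "geodesic_edge (parcs G) u v (a, b)"
    then obtain i j where *: "(a, b) \<in> parcs G" "(u, a) \<in> parcs G ^^ i" "(b, v) \<in> parcs G ^^ j"
      "\<And>k. (u, v) \<in> parcs G ^^ k \<Longrightarrow> i + j < k" by (rule geodesic_edgeE) (rule that)
    have ab: "a \<in> pverts G" "b \<in> pverts G" using * wf by auto
    have v: "v \<in> pverts G" using *(3) ab wf by (cases j) auto
    obtain xs ys where xs: "awalk u xs a" "length xs = i" and ys: "awalk b ys v" "length ys = j"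
      using relpow_awalk[of u a i] relpow_awalk[of b v j] * ab v by auto
    have "awalk u (xs @ (a, b) # ys) v"
      using xs ys *(1) by (intro awalk_appendI[OF xs(1)]) (auto simp: awalk_Cons_iff)
    then have "shortest_path G u (xs @ (a, b) # ys) v"
      unfolding shortest_path_iff using *(4) xs ys by (auto simp: Suc_le_eq)
    then show "\<exists>p. shortest_path G u p v \<and> (a, b) \<in> set p" by fastforce
  qed
qed

lemma edge_geodetic_set_iff: "edge_geodetic_set G S \<longleftrightarrow> geodetic (pverts G) (parcs G) {} S"
  unfolding edge_geodetic_set_def geodetic_def edge_on_shortest_path_iff by simp

lemma closed_edge_geodetic_set_iff:
  "closed_edge_geodetic_set G S \<longleftrightarrow>
    geodetic (pverts G) (parcs G) {(source G, target G)} S"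
proof -
  have "(\<exists>p. shortest_path G u p v \<and> e \<in> set p \<and> (u \<noteq> source G \<or> v \<noteq> target G)) \<longleftrightarrow>
    (u, v) \<notin> {(source G, target G)} \<and> geodesic_edge (parcs G) u v e" for u v e
    using edge_on_shortest_path_iff[of u v e] by auto
  then show ?thesis unfolding closed_edge_geodetic_set_def geodetic_def by simp
qed

lemma sp_eq_walk_dist:
  assumes "(source G, target G) \<in> (parcs G)\<^sup>*" "target G \<in> pverts G"
  shows "sp G = walk_dist (parcs G) (source G) (target G)"
proof -
  let ?s = "source G" and ?t = "target G"
  let ?d = "walk_dist (parcs G) ?s ?t"
  have d: "(?s, ?t) \<in> parcs G ^^ ?d" using assms(1) by (rule walk_dist_relpow)
  have len: "length p = ?d" if "shortest_path G ?s p ?t" for p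
    using that d awalk_relpow[of ?s p ?t] walk_dist_le[of ?s ?t "length p" "parcs G"]
    unfolding shortest_path_iff by (auto intro: le_antisym)
  obtain p where "awalk ?s p ?t" "length p = ?d"
    using relpow_awalk[of ?s ?t ?d] d assms(2) by auto
  then have "shortest_path G ?s p ?t"
    unfolding shortest_path_iff by (simp add: walk_dist_le)
  then have "(\<exists>p. shortest_path G ?s p ?t \<and> length p = k) \<longleftrightarrow> k = ?d" for k
    using len by auto
  then show ?thesis unfolding sp_def by (auto intro: Least_equality)
qed

end

section \<open>The parameters of a network\<close>

abbreviation network :: "'a st_digraph \<Rightarrow> bool" where
  "network G \<equiv> two_terminal (pverts G) (parcs G) (source G) (target G)"

abbreviation relabel :: "('a \<Rightarrow> 'a) \<Rightarrow> 'a rel \<Rightarrow> 'a rel" where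
  "relabel f R \<equiv> map_prod f f ` R"

lemma is_min_size_megs:
  assumes "network G"
  shows "is_min_size (pverts G) (parcs G) {} (megs G)"
proof -
  interpret two_terminal "pverts G" "parcs G" "source G" "target G" by fact
  show ?thesis
    unfolding megs_def edge_geodetic_set_iff[OF E_sub]
    by (rule is_min_size_Least[OF geodetic_all]) simp
qed

lemma megs_eqI:
  "network G \<Longrightarrow> is_min_size (pverts G) (parcs G) {} k \<Longrightarrow> megs G = k"
  using is_min_size_megs is_min_size_unique by blast

lemma cmegs_eq_Some_iff:
  assumes "network G"
  shows "cmegs G = Some k \<longleftrightarrow> is_min_size (pverts G) (parcs G) {(source G, target G)} k"
proof -
  interpret two_terminal "pverts G" "parcs G" "source G" "target G" by fact
  let ?geo = "geodetic (pverts G) (parcs G) {(source G, target G)}"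
  show ?thesis
  proof (cases "\<exists>S. ?geo S")
    case True
    then have "is_min_size (pverts G) (parcs G) {(source G, target G)} (LEAST k. \<exists>S. ?geo S \<and> card S = k)"
      using is_min_size_Least by blast
    with True show ?thesis
      unfolding cmegs_def closed_edge_geodetic_set_iff[OF E_sub]
      using is_min_size_unique by auto
  next
    case False
    then show ?thesis
      unfolding cmegs_def closed_edge_geodetic_set_iff[OF E_sub] is_min_size_def by simp
  qed
qed

lemma cmegs_eq_None_iff:
  assumes "network G"
  shows "cmegs G = None \<longleftrightarrow> (source G, target G) \<in> parcs G"
proof -
  interpret two_terminal "pverts G" "parcs G" "source G" "target G" by fact
  show ?thesis
    unfolding cmegs_def closed_edge_geodetic_set_iff[OF E_sub] geodetic_closed_iff by simp
qed

lemma sp_network: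
  assumes "network G"
  shows "sp G = walk_dist (parcs G) (source G) (target G)"
proof -
  interpret two_terminal "pverts G" "parcs G" "source G" "target G" by fact
  show ?thesis using from_s[OF t_in] t_in by (rule sp_eq_walk_dist[OF E_sub])
qed

text \<open>This is why the formula for \<^const>\<open>megs\<close> of a parallel composition never refers to an
  undefined value: it uses \<^const>\<open>cmegs\<close> only for the part with the larger \<^const>\<open>sp\<close>.\<close>

lemma cmegs_defined_of_sp:
  assumes "network G" "1 < sp G"
  shows "cmegs G \<noteq> None"
  using assms cmegs_eq_None_iff[OF assms(1)]
    walk_dist_le[of "source G" "target G" 1 "parcs G"] sp_network[OF assms(1)] by auto

lemma sp_pos: "network G \<Longrightarrow> 1 \<le> sp G"
  using two_terminal.walk_dist_pos[of "pverts G" "parcs G" "source G" "target G"]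
  by (simp add: sp_network)

section \<open>Compositions as gluings of networks\<close>

text \<open>The only edge that merging would lose is a loop at the removed vertex.\<close>

lemma merge_eq_relabel:
  assumes "(u', u') \<notin> R"
  shows "merge u' u R = relabel (id(u' := u)) R"
proof (intro equalityI subsetI)
  fix e assume "e \<in> merge u' u R"
  then obtain a b where "(a, b) \<in> R" "e = map_prod (id(u' := u)) (id(u' := u)) (a, b)"
    unfolding merge_def by force
  then show "e \<in> relabel (id(u' := u)) R" by blast
next
  fix e assume "e \<in> relabel (id(u' := u)) R"
  then obtain a b where "(a, b) \<in> R" "e = map_prod (id(u' := u)) (id(u' := u)) (a, b)"
    by (elim imageE) (metis surj_pair)
  with assms show "e \<in> merge u' u R"
    unfolding merge_def by (cases "a = u'"; cases "b = u'") auto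
qed

lemma relabel_outside:
  assumes "R \<subseteq> V \<times> V" "\<And>x. x \<in> V \<Longrightarrow> f x = x"
  shows "relabel f R = R"
proof -
  have "relabel f R = id ` R"
    using assms by (intro image_cong refl) auto
  then show ?thesis by simp
qed

lemma network_initial: "s \<noteq> t \<Longrightarrow> network (initial_spd s t)"
  by unfold_locales (auto simp: initial_spd_def)

context
  fixes G G' :: "'a st_digraph"
  assumes G: "network G" and G': "network G'" and disj: "pverts G \<inter> pverts G' = {}"
begin

interpretation G: two_terminal "pverts G" "parcs G" "source G" "target G" by (rule G)
interpretation G': two_terminal "pverts G'" "parcs G'" "source G'" "target G'" by (rule G')

text \<open>Renaming the merged terminals turns the second digraph into a network that shares exactly
  these terminals with the first one. The maps are injective on its vertices, because the
  vertex sets of the two digraphs are disjoint.\<close>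

definition "series_map = id(source G' := target G)"
definition "parallel_map = id(source G' := source G, target G' := target G)"

lemma apart: "x \<in> pverts G \<Longrightarrow> y \<in> pverts G' \<Longrightarrow> x \<noteq> y"
  using disj by blast

lemma series_map_simps:
  "series_map (source G') = target G" "series_map (target G') = target G'"
  "x \<in> pverts G \<Longrightarrow> series_map x = x"
  using G'.s_ne_t apart[of x "source G'"] G'.s_in by (auto simp: series_map_def)

lemma inj_series_map: "inj_on series_map (pverts G')"
  using apart[OF G.t_in] by (auto simp: inj_on_def series_map_def)

lemma series_verts: "pverts (G \<updownarrow> G') = pverts G \<union> series_map ` pverts G'"
  using G'.s_in G.t_in apart by (auto simp: series_comp_def series_map_def image_iff)

lemma series_arcs: "parcs (G \<updownarrow> G') = parcs G \<union> relabel series_map (parcs G')"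
proof -
  have "parcs (G \<updownarrow> G') = relabel series_map (parcs G \<union> parcs G')"
    unfolding series_comp_def series_map_def using G.no_loop G'.no_loop
    by (simp add: merge_eq_relabel)
  then show ?thesis
    using relabel_outside[OF G.E_sub, of series_map] series_map_simps(3) by (simp add: image_Un)
qed

lemma series_ends: "source (G \<updownarrow> G') = source G" "target (G \<updownarrow> G') = target G'"
  by (simp_all add: series_comp_def)

lemma series_glue_comp:
  "series_glue (pverts G) (parcs G) (source G) (target G)
     (series_map ` pverts G') (relabel series_map (parcs G')) (target G')"
proof -
  have "two_terminal (series_map ` pverts G') (relabel series_map (parcs G')) (target G) (target G')"
    using G'.image_two_terminal[OF inj_series_map] unfolding series_map_simps .
  moreover have "pverts G \<inter> series_map ` pverts G' = {target G}"
    using G'.s_in G.t_in apart by (auto simp: series_map_def image_iff)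
  ultimately show ?thesis
    using G by (simp add: series_glue_def series_glue_axioms_def)
qed

lemma network_series: "network (G \<updownarrow> G')"
  unfolding series_verts series_arcs series_ends
  by (rule series_glue.series_two_terminal[OF series_glue_comp])

lemma series_right_min_size:
  "is_min_size (series_map ` pverts G') (relabel series_map (parcs G')) {} k \<longleftrightarrow>
     is_min_size (pverts G') (parcs G') {} k"
  "is_min_size (series_map ` pverts G') (relabel series_map (parcs G')) {(target G, target G')} k \<longleftrightarrow>
     is_min_size (pverts G') (parcs G') {(source G', target G')} k"
  using is_min_size_image[OF inj_series_map G'.E_sub, of "{}"]
    is_min_size_image[OF inj_series_map G'.E_sub, of "{(source G', target G')}"] G'.s_in G'.t_in
  by (simp_all add: series_map_simps)

lemma sp_series: "sp (G \<updownarrow> G') = sp G + sp G'"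
proof -
  interpret series_glue "pverts G" "parcs G" "source G" "target G"
    "series_map ` pverts G'" "relabel series_map (parcs G')" "target G'" by (rule series_glue_comp)
  show ?thesis
    unfolding sp_network[OF G] sp_network[OF G'] sp_network[OF network_series] series_arcs series_ends
    using series_walk_dist walk_dist_image[OF inj_series_map G'.E_sub G'.s_in G'.t_in]
    by (simp add: series_map_simps)
qed

lemma megs_series: "megs (G \<updownarrow> G') = megs G + megs G' - 2"
proof (rule megs_eqI[OF network_series])
  interpret series_glue "pverts G" "parcs G" "source G" "target G"
    "series_map ` pverts G'" "relabel series_map (parcs G')" "target G'" by (rule series_glue_comp)
  show "is_min_size (pverts (G \<updownarrow> G')) (parcs (G \<updownarrow> G')) {} (megs G + megs G' - 2)"
    unfolding series_verts series_arcs
    by (rule series_min_size) (simp_all add: series_right_min_size is_min_size_megs[OF G] is_min_size_megs[OF G'])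
qed

lemma cmegs_series:
  "cmegs (G \<updownarrow> G') =
    (if (megs G > 2 \<and> megs G' > 2) \<or> Some (megs G) = cmegs G \<or> Some (megs G') = cmegs G'
     then Some (megs G + megs G' - 2) else Some (megs G + megs G' - 1))"
proof -
  interpret series_glue "pverts G" "parcs G" "source G" "target G"
    "series_map ` pverts G'" "relabel series_map (parcs G')" "target G'" by (rule series_glue_comp)
  have "is_min_size (series_map ` pverts G') (relabel series_map (parcs G')) {} (megs G')"
    using is_min_size_megs[OF G'] unfolding series_right_min_size .
  from series_closed_min_size[OF is_min_size_megs[OF G] this]
  have "cmegs (G \<updownarrow> G') = Some (if 2 < megs G \<and> 2 < megs G' \<or> cmegs G = Some (megs G) \<or> cmegs G' = Some (megs G')
      then megs G + megs G' - 2 else megs G + megs G' - 1)"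
    unfolding cmegs_eq_Some_iff[OF network_series] cmegs_eq_Some_iff[OF G] cmegs_eq_Some_iff[OF G']
      series_verts series_arcs series_ends series_right_min_size .
  then show ?thesis unfolding eq_commute[of "Some (megs _)"] by (simp only: if_distrib[of Some])
qed

lemma parallel_map_simps:
  "parallel_map (source G') = source G" "parallel_map (target G') = target G"
  "x \<in> pverts G \<Longrightarrow> parallel_map x = x"
  using G'.s_ne_t apart[of x "source G'"] apart[of x "target G'"] G'.s_in G'.t_in
  by (auto simp: parallel_map_def)

lemma inj_parallel_map: "inj_on parallel_map (pverts G')"
  using apart[OF G.t_in] apart[OF G.s_in] G.s_ne_t
  by (auto simp: inj_on_def parallel_map_def)

lemma parallel_map_image:
  "parallel_map ` pverts G' = insert (source G) (insert (target G) (pverts G' - {source G', target G'}))"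
  using G'.s_in G'.t_in G'.s_ne_t by (auto simp: parallel_map_def image_iff)

lemma parallel_verts: "pverts (G \<leftrightarrow> G') = pverts G \<union> parallel_map ` pverts G'"
proof -
  have "source G' \<notin> pverts G" "target G' \<notin> pverts G"
    using apart G'.s_in G'.t_in by blast+
  then show ?thesis using G.s_in G.t_in by (auto simp: parallel_comp_def parallel_map_image)
qed

lemma parallel_arcs: "parcs (G \<leftrightarrow> G') = parcs G \<union> relabel parallel_map (parcs G')"
proof -
  let ?R = "parcs G \<union> parcs G'"
  let ?t = "id(target G' := target G)" and ?s = "id(source G' := source G)"
  have ne: "target G \<noteq> source G'" using apart G.t_in G'.s_in by blast
  have t: "merge (target G') (target G) ?R = relabel ?t ?R"
    using G.no_loop G'.no_loop by (intro merge_eq_relabel) auto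
  have "(source G', source G') \<notin> relabel ?t ?R"
    using G.no_loop G'.no_loop ne by (auto split: if_splits)
  then have "parcs (G \<leftrightarrow> G') = relabel ?s (relabel ?t ?R)"
    unfolding parallel_comp_def by (simp add: t merge_eq_relabel)
  also have "\<dots> = relabel (?s \<circ> ?t) ?R"
    by (simp only: image_comp map_prod.comp)
  also have "?s \<circ> ?t = parallel_map"
    using ne G'.s_ne_t by (auto simp: parallel_map_def fun_eq_iff)
  finally show ?thesis
    using relabel_outside[OF G.E_sub, of parallel_map] parallel_map_simps(3) by (simp add: image_Un)
qed

lemma parallel_ends: "source (G \<leftrightarrow> G') = source G" "target (G \<leftrightarrow> G') = target G"
  by (simp_all add: parallel_comp_def)

lemma parallel_glue_comp:
  "parallel_glue (pverts G) (parcs G) (source G) (target G)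
     (parallel_map ` pverts G') (relabel parallel_map (parcs G'))"
proof -
  have "two_terminal (parallel_map ` pverts G') (relabel parallel_map (parcs G')) (source G) (target G)"
    using G'.image_two_terminal[OF inj_parallel_map] unfolding parallel_map_simps .
  moreover have "pverts G \<inter> parallel_map ` pverts G' = {source G, target G}"
    using G.s_in G.t_in disj by (auto simp: parallel_map_image)
  ultimately show ?thesis
    using G by (simp add: parallel_glue_def parallel_glue_axioms_def)
qed

lemma network_parallel: "network (G \<leftrightarrow> G')"
  unfolding parallel_verts parallel_arcs parallel_ends
  by (rule parallel_glue.parallel_two_terminal[OF parallel_glue_comp])

lemma parallel_right_min_size:
  "is_min_size (parallel_map ` pverts G') (relabel parallel_map (parcs G')) {} k \<longleftrightarrow>
     is_min_size (pverts G') (parcs G') {} k"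
  "is_min_size (parallel_map ` pverts G') (relabel parallel_map (parcs G')) {(source G, target G)} k \<longleftrightarrow>
     is_min_size (pverts G') (parcs G') {(source G', target G')} k"
  using is_min_size_image[OF inj_parallel_map G'.E_sub, of "{}"]
    is_min_size_image[OF inj_parallel_map G'.E_sub, of "{(source G', target G')}"] G'.s_in G'.t_in
  by (simp_all add: parallel_map_simps)

lemma parallel_right_walk_dist:
  "walk_dist (relabel parallel_map (parcs G')) (source G) (target G) = sp G'"
  using walk_dist_image[OF inj_parallel_map G'.E_sub G'.s_in G'.t_in]
  by (simp add: parallel_map_simps sp_network[OF G'])

lemma sp_parallel: "sp (G \<leftrightarrow> G') = min (sp G) (sp G')"
  using parallel_glue.parallel_walk_dist[OF parallel_glue_comp]
  by (simp add: sp_network[OF G] sp_network[OF network_parallel] parallel_arcs parallel_ends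
      flip: parallel_right_walk_dist)

lemma min_size_parallel:
  assumes "is_min_size (pverts G) (parcs G)
      (F \<union> (if sp G' < sp G then {(source G, target G)} else {})) k"
    and "is_min_size (parallel_map ` pverts G') (relabel parallel_map (parcs G'))
      (F \<union> (if sp G < sp G' then {(source G, target G)} else {})) k'"
  shows "is_min_size (pverts (G \<leftrightarrow> G')) (parcs (G \<leftrightarrow> G')) F (k + k' - 2)"
proof -
  interpret parallel_glue "pverts G" "parcs G" "source G" "target G"
    "parallel_map ` pverts G'" "relabel parallel_map (parcs G')" by (rule parallel_glue_comp)
  show ?thesis
    unfolding parallel_verts parallel_arcs
    by (rule parallel_min_size)
      (use assms in \<open>simp_all add: left_forbidden_def right_forbidden_def parallel_right_walk_dist
        flip: sp_network[OF G]\<close>)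
qed

lemma megs_parallel:
  "Some (megs (G \<leftrightarrow> G')) =
    (if sp G = sp G' then Some (megs G + megs G' - 2)
     else if sp G < sp G' then map_option (\<lambda>c'. megs G + c' - 2) (cmegs G')
     else map_option (\<lambda>c. c + megs G' - 2) (cmegs G))"
proof -
  note megs = is_min_size_megs[OF G] is_min_size_megs[OF G']
  consider "sp G = sp G'" | "sp G < sp G'" | "sp G' < sp G" by linarith
  then show ?thesis
  proof cases
    case 1
    have "megs (G \<leftrightarrow> G') = megs G + megs G' - 2"
      using 1 megs by (intro megs_eqI[OF network_parallel] min_size_parallel) (simp_all add: parallel_right_min_size)
    with 1 show ?thesis by simp
  next
    case 2
    then obtain c' where c': "cmegs G' = Some c'"
      using cmegs_defined_of_sp[OF G'] sp_pos[OF G] by fastforce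
    have "megs (G \<leftrightarrow> G') = megs G + c' - 2"
      using 2 megs c'[unfolded cmegs_eq_Some_iff[OF G']]
      by (intro megs_eqI[OF network_parallel] min_size_parallel) (simp_all add: parallel_right_min_size)
    with 2 c' show ?thesis by simp
  next
    case 3
    then obtain c where c: "cmegs G = Some c"
      using cmegs_defined_of_sp[OF G] sp_pos[OF G'] by fastforce
    have "megs (G \<leftrightarrow> G') = c + megs G' - 2"
      using 3 megs c[unfolded cmegs_eq_Some_iff[OF G]]
      by (intro megs_eqI[OF network_parallel] min_size_parallel) (simp_all add: parallel_right_min_size)
    with 3 c show ?thesis by simp
  qed
qed

lemma cmegs_parallel:
  "cmegs (G \<leftrightarrow> G') =
    (case (cmegs G, cmegs G') of (Some c, Some c') \<Rightarrow> Some (c + c' - 2) | _ \<Rightarrow> None)"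
proof -
  have some: "cmegs (G \<leftrightarrow> G') = Some (c + c' - 2)" if "cmegs G = Some c" "cmegs G' = Some c'" for c c'
    using that unfolding cmegs_eq_Some_iff[OF G] cmegs_eq_Some_iff[OF G'] cmegs_eq_Some_iff[OF network_parallel]
    by (intro min_size_parallel) (simp_all add: parallel_ends parallel_right_min_size)
  have none: "cmegs (G \<leftrightarrow> G') = None" if "cmegs G = None \<or> cmegs G' = None"
  proof -
    have "(source G', target G') \<in> parcs G' \<Longrightarrow> (source G, target G) \<in> relabel parallel_map (parcs G')"
      by (rule image_eqI[of _ _ "(source G', target G')"]) (simp_all add: parallel_map_simps)
    then show ?thesis
      using that unfolding cmegs_eq_None_iff[OF G] cmegs_eq_None_iff[OF G']
        cmegs_eq_None_iff[OF network_parallel] parallel_arcs parallel_ends by blast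
  qed
  show ?thesis using some none by (auto split: option.split)
qed

end

section \<open>The recursion\<close>

lemma series_parallel_network: "series_parallel G \<Longrightarrow> network G"
  by (induction rule: series_parallel.induct)
    (simp_all add: network_initial network_series network_parallel)

lemma initial_values:
  assumes "s \<noteq> t"
  shows "sp (initial_spd s t) = 1" "megs (initial_spd s t) = 2" "cmegs (initial_spd s t) = None"
proof -
  note net = network_initial[OF assms]
  interpret two_terminal "{s, t}" "{(s, t)}" s t
    using net by (simp add: initial_spd_def)
  show "sp (initial_spd s t) = 1"
    using sp_network[OF net] walk_dist_le[of s t 1 "{(s, t)}"] walk_dist_pos
    by (simp add: initial_spd_def)
  show "cmegs (initial_spd s t) = None"
    using cmegs_eq_None_iff[OF net] by (simp add: initial_spd_def)
  have "is_min_size {s, t} {(s, t)} {} 2"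
    using geodetic_all[of "{}"] geodetic_card assms by (intro is_min_sizeI[of _ _ _ "{s, t}"]) auto
  then show "megs (initial_spd s t) = 2"
    by (intro megs_eqI[OF net]) (simp add: initial_spd_def)
qed

theorem theorem6:
  shows "(\<forall>s t :: 'a. s \<noteq> t \<longrightarrow>
            sp (initial_spd s t) = 1 \<and>
            megs (initial_spd s t) = 2 \<and>
            cmegs (initial_spd s t) = None) \<and>
         (\<forall>G G' :: 'a st_digraph.
            series_parallel G \<and> series_parallel G' \<and> pverts G \<inter> pverts G' = {} \<longrightarrow>
            sp (G \<updownarrow> G') = sp G + sp G' \<and>
            megs (G \<updownarrow> G') = megs G + megs G' - 2 \<and>
            cmegs (G \<updownarrow> G') =
              (if (megs G > 2 \<and> megs G' > 2) \<or> Some (megs G) = cmegs G \<or> Some (megs G') = cmegs G'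
               then Some (megs G + megs G' - 2)
               else Some (megs G + megs G' - 1))) \<and>
         (\<forall>G G' :: 'a st_digraph.
            series_parallel G \<and> series_parallel G' \<and> pverts G \<inter> pverts G' = {} \<longrightarrow>
            sp (G \<leftrightarrow> G') = min (sp G) (sp G') \<and>
            Some (megs (G \<leftrightarrow> G')) =
              (if sp G = sp G' then Some (megs G + megs G' - 2)
               else if sp G < sp G' then map_option (\<lambda>c'. megs G + c' - 2) (cmegs G')
               else map_option (\<lambda>c. c + megs G' - 2) (cmegs G)) \<and>
            cmegs (G \<leftrightarrow> G') =
              (case (cmegs G, cmegs G') of
                 (Some c, Some c') \<Rightarrow> Some (c + c' - 2)
               | _ \<Rightarrow> None))"
proof (intro conjI allI impI; (elim conjE)?)
  fix G G' :: "'a st_digraph"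
  assume "series_parallel G" "series_parallel G'" and disj: "pverts G \<inter> pverts G' = {}"
  then have net: "network G" "network G'" by (simp_all add: series_parallel_network)
  show "sp (G \<updownarrow> G') = sp G + sp G'" "megs (G \<updownarrow> G') = megs G + megs G' - 2"
    "cmegs (G \<updownarrow> G') =
      (if (megs G > 2 \<and> megs G' > 2) \<or> Some (megs G) = cmegs G \<or> Some (megs G') = cmegs G'
       then Some (megs G + megs G' - 2) else Some (megs G + megs G' - 1))"
    by (rule sp_series[OF net disj] megs_series[OF net disj] cmegs_series[OF net disj])+
  show "sp (G \<leftrightarrow> G') = min (sp G) (sp G')"
    "Some (megs (G \<leftrightarrow> G')) =
      (if sp G = sp G' then Some (megs G + megs G' - 2)
       else if sp G < sp G' then map_option (\<lambda>c'. megs G + c' - 2) (cmegs G')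
       else map_option (\<lambda>c. c + megs G' - 2) (cmegs G))"
    "cmegs (G \<leftrightarrow> G') =
      (case (cmegs G, cmegs G') of (Some c, Some c') \<Rightarrow> Some (c + c' - 2) | _ \<Rightarrow> None)"
    by (rule sp_parallel[OF net disj] megs_parallel[OF net disj] cmegs_parallel[OF net disj])+
qed (simp_all only: initial_values not_False_eq_True)

end
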